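(* Let $n_1,n_2\ge1$, $n=n_1+n_2$, and for $i=1,2$ let $\pi_i$ be an $R$-representation of $G_{n_i}=\mathrm{GL}_{n_i}(\mathbf{k})$. Let $V_{\pi_1\times\pi_2}$ be the space of $\pi_1\times\pi_2$, let $W_2\subseteq W_1\subseteq V_{\pi_1\times\pi_2}$ be $G_n$-stable submodules, and let $\pi$ be the subquotient representation of $G_n$ on $W_1/W_2$, assumed nonzero. Assume that the restriction map $\mathrm{Hom}_R(V_{\pi_1\times\pi_2},R)\to\mathrm{Hom}_R(W_1,R)$ is surjective, and that both $\pi_1$ and $\pi_2$ satisfy $(\mathbf{GJFE},\psi)$ (resp. $(\mathbf{WGJFE},\psi)$). Then $\pi$ satisfies $(\mathbf{GJFE},\psi)$ (resp. $(\mathbf{WGJFE},\psi)$), and moreover $$\gamma(\pi,\psi)=\gamma(\pi_1,\psi)\,\gamma(\pi_2,\psi).$$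
   Context: $\mathbf{k}$ is a finite field of characteristic $p$ and cardinality $q$; $R$ is a commutative $\mathbb{Z}[\mu_p]$-algebra ($\mu_p\subset\mathbb{C}^\times$ the $p$-th roots of unity) with $\mu_p\to R^\times$ injective, such that $R^\times$ contains square roots of the cardinalities $|M_m(\mathbf{k})|$ for $m\in\{n_1,n_2,n\}$, which are fixed compatibly: $|M_n(\mathbf{k})|^{1/2}=q^{n_1n_2}|M_{n_1}(\mathbf{k})|^{1/2}|M_{n_2}(\mathbf{k})|^{1/2}$. $\psi:\mathbf{k}\to R^\times$ is a fixed non-trivial spectral character, i.e. the composition of a non-trivial homomorphism $\mathbf{k}\to\mu_p$ with $\mu_p\to R^\times$. For $m\ge1$, $G_m=\mathrm{GL}_m(\mathbf{k})$, and for $\Phi:M_m(\mathbf{k})\to R$, $\widehat\Phi(a)=|M_m(\mathbf{k})|^{-1/2}\sum_{g\in M_m(\mathbf{k})}\Phi(g)\psi(\mathrm{tr}(ga))$. An $R$-representation $(\rho,V)$ of $G_m$, with $V^\vee=\mathrm{Hom}_R(V,R)$, satisfies $(\mathbf{GJFE},\psi)$ (resp. $(\mathbf{WGJFE},\psi)$) if there is $\gamma(\rho,\psi)\in R$ with $$\sum_{g\in G_m}\widehat\Phi(g)v^\vee(\rho(g^{-1})v)=\gamma(\rho,\psi)\sum_{g\in G_m}\Phi(g)v^\vee(\rho(g)v)$$ for all $v\in V$, $v^\vee\in V^\vee$ and all functions $\Phi:M_m(\mathbf{k})\to R$ (resp. all $\Phi:M_m(\mathbf{k})\to R$ supported on $G_m$).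 Such an element is called a gamma factor of $\rho$; the displayed equality in the claim means that the product of gamma factors of $\pi_1,\pi_2$ is a gamma factor for $\pi$. $\pi_1\times\pi_2=\mathrm{Ind}_{P_{(n_1,n_2)}}^{G_n}(\pi_1\otimes\pi_2)$, where $P_{(n_1,n_2)}$ is the block upper triangular parabolic subgroup of $G_n$ with Levi factor $G_{n_1}\times G_{n_2}$ and $\pi_1\otimes\pi_2$ is inflated to it. *)

theory Defs
  imports
    "Jordan_Normal_Form.VS_Connect"
    "HOL-Algebra.Group_Action"
    "HOL-Algebra.Generated_Rings"
    "HOL-Computational_Algebra.Primes"
begin

text \<open>
  The base field is a type \<open>'k\<close> of class \<open>finite_field\<close> and the coefficient ring a type
  \<open>'r\<close> of class \<open>comm_ring_1\<close>, viewed as a HOL-Algebra ring via \<^const>\<open>class_ring\<close>;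
  modules over it are HOL-Algebra modules with explicit carriers.  The fields \<open>mult\<close> and
  \<open>one\<close>, which the record type \<open>module\<close> inherits from \<open>ring\<close>, play no role for modules.
\<close>

section \<open>Scalars\<close>

definition roots_of_unity :: "nat \<Rightarrow> complex set" where
  "roots_of_unity p = {z. z ^ p = 1}"

text \<open>The subring \<open>\<int>[\<mu>\<^sub>p]\<close> of the complex numbers.\<close>

definition cyclotomic_ring :: "nat \<Rightarrow> complex ring" where
  "cyclotomic_ring p = class_ring\<lparr>carrier := generate_ring class_ring (roots_of_unity p)\<rparr>"

text \<open>
  \<open>\<phi>\<close> is the structure map of a \<open>\<int>[\<mu>\<^sub>p]\<close>-algebra \<open>'r\<close>; its values outside
  \<open>\<int>[\<mu>\<^sub>p]\<close> are irrelevant.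
\<close>

definition nontrivial_spectral_character ::
    "(complex \<Rightarrow> 'r::comm_ring_1) \<Rightarrow> ('k::finite_field \<Rightarrow> 'r) \<Rightarrow> bool" where
  "nontrivial_spectral_character \<phi> \<psi> \<longleftrightarrow>
     (\<exists>\<chi>. (\<forall>x. \<chi> x \<in> roots_of_unity CHAR('k)) \<and> (\<forall>x y. \<chi> (x + y) = \<chi> x * \<chi> y) \<and>
          (\<exists>x. \<chi> x \<noteq> 1) \<and> \<psi> = \<phi> \<circ> \<chi>)"


section \<open>Matrices and the Fourier transform\<close>

definition GL :: "nat \<Rightarrow> 'k::field mat monoid" where
  "GL m = units_of (ring_mat TYPE('k) m ())"

definition mat_trace :: "'a::comm_monoid_add mat \<Rightarrow> 'a" where
  "mat_trace A = (\<Sum>i<dim_row A. A $$ (i, i))"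

text \<open>
  \<open>s\<close> is the chosen square root of the cardinality of \<open>M\<^sub>m(k)\<close>, a unit of the ring.
  A function on \<open>M\<^sub>m(k)\<close> is given by a total function on \<open>'k mat\<close>, of which only the values on
  \<open>carrier_mat m m\<close> are used.
\<close>

definition fourier ::
    "'r::comm_ring_1 \<Rightarrow> ('k::finite_field \<Rightarrow> 'r) \<Rightarrow> nat \<Rightarrow> ('k mat \<Rightarrow> 'r) \<Rightarrow> 'k mat \<Rightarrow> 'r" where
  "fourier s \<psi> m \<Phi> a =
     inv\<^bsub>class_ring\<^esub> s * (\<Sum>g\<in>carrier_mat m m. \<Phi> g * \<psi> (mat_trace (g * a)))"


section \<open>Representations and gamma factors\<close>

definition representation ::
    "('g, 'x) monoid_scheme \<Rightarrow> ('r::comm_ring_1, 'v) module \<Rightarrow> ('g \<Rightarrow> 'v \<Rightarrow> 'v) \<Rightarrow> bool" where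
  "representation G V \<rho> \<longleftrightarrow>
     Module.module class_ring V \<and> group_action G (carrier V) \<rho> \<and>
     (\<forall>g\<in>carrier G. \<rho> g \<in> LinearCombinations.module_hom class_ring V V)"

definition scalar_module :: "('r::comm_ring_1, 'r) module" where
  "scalar_module = \<lparr>carrier = UNIV, mult = (*), one = 1, zero = 0, add = (+), smult = (*)\<rparr>"

text \<open>\<open>Hom\<^sub>R(V, R)\<close>, as extensional functions so that equal functionals are equal in HOL.\<close>

definition dual :: "('r::comm_ring_1, 'v) module \<Rightarrow> ('v \<Rightarrow> 'r) set" where
  "dual V = LinearCombinations.module_hom class_ring V scalar_module \<inter> extensional (carrier V)"

definition gamma_factor ::
    "('k mat \<Rightarrow> 'r) set \<Rightarrow> 'r \<Rightarrow> ('k \<Rightarrow> 'r) \<Rightarrow> nat \<Rightarrow>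
     ('r::comm_ring_1, 'v) module \<Rightarrow> ('k::finite_field mat \<Rightarrow> 'v \<Rightarrow> 'v) \<Rightarrow> 'r \<Rightarrow> bool" where
  "gamma_factor T s \<psi> m V \<rho> \<gamma> \<longleftrightarrow>
     (\<forall>v\<in>carrier V. \<forall>l\<in>dual V. \<forall>\<Phi>\<in>T.
        (\<Sum>g\<in>carrier (GL m). fourier s \<psi> m \<Phi> g * l (\<rho> (inv\<^bsub>GL m\<^esub> g) v)) =
        \<gamma> * (\<Sum>g\<in>carrier (GL m). \<Phi> g * l (\<rho> g v)))"

definition GL_supported :: "nat \<Rightarrow> ('k::field mat \<Rightarrow> 'r::zero) set" where
  "GL_supported m = {\<Phi>. \<forall>g \<in> carrier_mat m m - carrier (GL m). \<Phi> g = 0}"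

abbreviation "GJFE_gamma \<equiv> gamma_factor UNIV"

abbreviation "WGJFE_gamma s \<psi> m \<equiv> gamma_factor (GL_supported m) s \<psi> m"

definition GJFE ::
    "'r \<Rightarrow> ('k \<Rightarrow> 'r) \<Rightarrow> nat \<Rightarrow>
     ('r::comm_ring_1, 'v) module \<Rightarrow> ('k::finite_field mat \<Rightarrow> 'v \<Rightarrow> 'v) \<Rightarrow> bool" where
  "GJFE s \<psi> m V \<rho> \<longleftrightarrow> (\<exists>\<gamma>. GJFE_gamma s \<psi> m V \<rho> \<gamma>)"

definition WGJFE ::
    "'r \<Rightarrow> ('k \<Rightarrow> 'r) \<Rightarrow> nat \<Rightarrow>
     ('r::comm_ring_1, 'v) module \<Rightarrow> ('k::finite_field mat \<Rightarrow> 'v \<Rightarrow> 'v) \<Rightarrow> bool" where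
  "WGJFE s \<psi> m V \<rho> \<longleftrightarrow> (\<exists>\<gamma>. WGJFE_gamma s \<psi> m V \<rho> \<gamma>)"


section \<open>Quotient modules and subquotient representations\<close>

text \<open>
  The map on cosets \<open>N +> x \<mapsto> N' +> h x\<close> induced by a homomorphism \<open>h\<close> into \<open>M'\<close> that maps
  \<open>N\<close> into \<open>N'\<close>: all the cosets in the union are then equal.
\<close>

definition coset_map ::
    "('r, 'w) module \<Rightarrow> 'w set \<Rightarrow> ('v \<Rightarrow> 'w) \<Rightarrow> 'v set \<Rightarrow> 'w set" where
  "coset_map M' N' h X = (\<Union>x\<in>X. N' +>\<^bsub>M'\<^esub> h x)"

definition quotient_module :: "('r, 'v) module \<Rightarrow> 'v set \<Rightarrow> ('r, 'v set) module" where
  "quotient_module M N =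
     \<lparr>carrier = a_rcosets\<^bsub>M\<^esub> N, mult = undefined, one = undefined,
      zero = N, add = (\<lambda>X Y. X <+>\<^bsub>M\<^esub> Y),
      smult = (\<lambda>r. coset_map M N (\<lambda>x. r \<odot>\<^bsub>M\<^esub> x))\<rparr>"

definition stable :: "('g, 'x) monoid_scheme \<Rightarrow> ('g \<Rightarrow> 'v \<Rightarrow> 'v) \<Rightarrow> 'v set \<Rightarrow> bool" where
  "stable G \<rho> W \<longleftrightarrow> (\<forall>g\<in>carrier G. \<forall>w\<in>W. \<rho> g w \<in> W)"

definition subquotient_module ::
    "('r, 'v) module \<Rightarrow> 'v set \<Rightarrow> 'v set \<Rightarrow> ('r, 'v set) module" where
  "subquotient_module V W1 W2 = quotient_module (V\<lparr>carrier := W1\<rparr>) W2"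

definition subquotient_action ::
    "('r, 'v) module \<Rightarrow> ('g \<Rightarrow> 'v \<Rightarrow> 'v) \<Rightarrow> 'v set \<Rightarrow> 'v set \<Rightarrow> 'g \<Rightarrow> 'v set \<Rightarrow> 'v set" where
  "subquotient_action V \<rho> W1 W2 g =
     restrict (coset_map (V\<lparr>carrier := W1\<rparr>) W2 (\<rho> g)) (carrier (subquotient_module V W1 W2))"


section \<open>Tensor products\<close>

definition free_module :: "'s set \<Rightarrow> ('r::comm_ring_1, 's \<Rightarrow> 'r) module" where
  "free_module S =
     \<lparr>carrier = {f. finite {x. f x \<noteq> 0} \<and> (\<forall>x. x \<notin> S \<longrightarrow> f x = 0)},
      mult = undefined, one = undefined, zero = (\<lambda>_. 0), add = (\<lambda>f g x. f x + g x),
      smult = (\<lambda>r f x. r * f x)\<rparr>"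

definition free_gen :: "'s \<Rightarrow> 's \<Rightarrow> 'r::comm_ring_1" where
  "free_gen x = (\<lambda>y. if y = x then 1 else 0)"

text \<open>The linear map between free modules extending \<open>h\<close> on the generators.\<close>

definition free_map :: "('s \<Rightarrow> 't) \<Rightarrow> ('s \<Rightarrow> 'r::comm_ring_1) \<Rightarrow> 't \<Rightarrow> 'r" where
  "free_map h f = (\<lambda>y. \<Sum>x | f x \<noteq> 0 \<and> h x = y. f x)"

definition bilinear_relations ::
    "('r::comm_ring_1, 'a) module \<Rightarrow> ('r, 'b) module \<Rightarrow> ('a \<times> 'b \<Rightarrow> 'r) set" where
  "bilinear_relations V W =
     {\<lambda>z. free_gen (v \<oplus>\<^bsub>V\<^esub> v', w) z - free_gen (v, w) z - free_gen (v', w) z | v v' w.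
        v \<in> carrier V \<and> v' \<in> carrier V \<and> w \<in> carrier W} \<union>
     {\<lambda>z. free_gen (v, w \<oplus>\<^bsub>W\<^esub> w') z - free_gen (v, w) z - free_gen (v, w') z | v w w'.
        v \<in> carrier V \<and> w \<in> carrier W \<and> w' \<in> carrier W} \<union>
     {\<lambda>z. free_gen (r \<odot>\<^bsub>V\<^esub> v, w) z - r * free_gen (v, w) z | r v w.
        v \<in> carrier V \<and> w \<in> carrier W} \<union>
     {\<lambda>z. free_gen (v, r \<odot>\<^bsub>W\<^esub> w) z - r * free_gen (v, w) z | r v w.
        v \<in> carrier V \<and> w \<in> carrier W}"

definition tensor_kernel ::
    "('r::comm_ring_1, 'a) module \<Rightarrow> ('r, 'b) module \<Rightarrow> ('a \<times> 'b \<Rightarrow> 'r) set" where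
  "tensor_kernel V W =
     LinearCombinations.module.span class_ring (free_module (carrier V \<times> carrier W))
       (bilinear_relations V W)"

definition tensor_module ::
    "('r::comm_ring_1, 'a) module \<Rightarrow> ('r, 'b) module \<Rightarrow> ('r, ('a \<times> 'b \<Rightarrow> 'r) set) module" where
  "tensor_module V W =
     quotient_module (free_module (carrier V \<times> carrier W)) (tensor_kernel V W)"

text \<open>The action of a pair \<open>(g, h)\<close> by \<open>\<rho> g \<otimes> \<sigma> h\<close>.\<close>

definition tensor_action ::
    "('r::comm_ring_1, 'a) module \<Rightarrow> ('g \<Rightarrow> 'a \<Rightarrow> 'a) \<Rightarrow>
     ('r, 'b) module \<Rightarrow> ('h \<Rightarrow> 'b \<Rightarrow> 'b) \<Rightarrow>
     'g \<times> 'h \<Rightarrow> ('a \<times> 'b \<Rightarrow> 'r) set \<Rightarrow> ('a \<times> 'b \<Rightarrow> 'r) set" where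
  "tensor_action V \<rho> W \<sigma> = (\<lambda>(g, h).
     restrict
       (coset_map (free_module (carrier V \<times> carrier W)) (tensor_kernel V W)
         (free_map (map_prod (\<rho> g) (\<sigma> h))))
       (carrier (tensor_module V W)))"


section \<open>Parabolic induction\<close>

text \<open>
  \<open>Ind\<^sub>P\<^sup>G \<sigma>\<close> consists of the functions \<open>f\<close> on \<open>G\<close> with \<open>f(pg) = \<sigma>(p) f(g)\<close>, on which \<open>G\<close> acts by
  right translation.
\<close>

definition induced_module ::
    "('g, 'x) monoid_scheme \<Rightarrow> 'g set \<Rightarrow> ('r, 'v) module \<Rightarrow> ('g \<Rightarrow> 'v \<Rightarrow> 'v) \<Rightarrow>
     ('r, 'g \<Rightarrow> 'v) module" where
  "induced_module G P V \<sigma> =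
     \<lparr>carrier = {f \<in> carrier G \<rightarrow>\<^sub>E carrier V.
                   \<forall>p\<in>P. \<forall>g\<in>carrier G. f (p \<otimes>\<^bsub>G\<^esub> g) = \<sigma> p (f g)},
      mult = undefined, one = undefined,
      zero = (\<lambda>g\<in>carrier G. \<zero>\<^bsub>V\<^esub>),
      add = (\<lambda>f f'. \<lambda>g\<in>carrier G. f g \<oplus>\<^bsub>V\<^esub> f' g),
      smult = (\<lambda>r f. \<lambda>g\<in>carrier G. r \<odot>\<^bsub>V\<^esub> f g)\<rparr>"

definition induced_action ::
    "('g, 'x) monoid_scheme \<Rightarrow> 'g set \<Rightarrow> ('r, 'v) module \<Rightarrow> ('g \<Rightarrow> 'v \<Rightarrow> 'v) \<Rightarrow>
     'g \<Rightarrow> ('g \<Rightarrow> 'v) \<Rightarrow> ('g \<Rightarrow> 'v)" where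
  "induced_action G P V \<sigma> x =
     (\<lambda>f\<in>carrier (induced_module G P V \<sigma>). \<lambda>g\<in>carrier G. f (g \<otimes>\<^bsub>G\<^esub> x))"

definition parabolic :: "nat \<Rightarrow> nat \<Rightarrow> 'k::field mat set" where
  "parabolic n1 n2 =
     {four_block_mat a b (0\<^sub>m n2 n1) d | a b d.
        a \<in> carrier (GL n1) \<and> b \<in> carrier_mat n1 n2 \<and> d \<in> carrier (GL n2)}"

text \<open>Inflation to the parabolic of a representation of its Levi factor.\<close>

definition inflate :: "nat \<Rightarrow> nat \<Rightarrow> ('k mat \<times> 'k mat \<Rightarrow> 'c) \<Rightarrow> 'k mat \<Rightarrow> 'c" where
  "inflate n1 n2 \<tau> p = (case split_block p n1 n1 of (a, b, c, d) \<Rightarrow> \<tau> (a, d))"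

definition parabolic_product_module ::
    "nat \<Rightarrow> nat \<Rightarrow> ('r::comm_ring_1, 'a) module \<Rightarrow> ('k::field mat \<Rightarrow> 'a \<Rightarrow> 'a) \<Rightarrow>
     ('r, 'b) module \<Rightarrow> ('k mat \<Rightarrow> 'b \<Rightarrow> 'b) \<Rightarrow>
     ('r, 'k mat \<Rightarrow> ('a \<times> 'b \<Rightarrow> 'r) set) module" where
  "parabolic_product_module n1 n2 V1 \<pi>1 V2 \<pi>2 =
     induced_module (GL (n1 + n2)) (parabolic n1 n2) (tensor_module V1 V2)
       (inflate n1 n2 (tensor_action V1 \<pi>1 V2 \<pi>2))"

definition parabolic_product_action ::
    "nat \<Rightarrow> nat \<Rightarrow> ('r::comm_ring_1, 'a) module \<Rightarrow> ('k::field mat \<Rightarrow> 'a \<Rightarrow> 'a) \<Rightarrow>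
     ('r, 'b) module \<Rightarrow> ('k mat \<Rightarrow> 'b \<Rightarrow> 'b) \<Rightarrow>
     'k mat \<Rightarrow> ('k mat \<Rightarrow> ('a \<times> 'b \<Rightarrow> 'r) set) \<Rightarrow> ('k mat \<Rightarrow> ('a \<times> 'b \<Rightarrow> 'r) set)" where
  "parabolic_product_action n1 n2 V1 \<pi>1 V2 \<pi>2 =
     induced_action (GL (n1 + n2)) (parabolic n1 n2) (tensor_module V1 V2)
       (inflate n1 n2 (tensor_action V1 \<pi>1 V2 \<pi>2))"

end

theory Submission
  imports Defs
begin

text \<open>
  Functionals on the induced module are sums of functionals of the values at a set of representatives
  of \<open>P\G\<close>.  Splitting the sums over \<open>G\<close> along the cosets of \<open>P\<close> and translating \<open>\<Phi>\<close> reduces the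
  functional equation of \<open>\<pi>\<^sub>1 \<times> \<pi>\<^sub>2\<close> to one on \<open>P\<close>.  There the sum of the Fourier transform of \<open>\<Phi>\<close> over
  the unipotent radical is the Fourier transform in both diagonal blocks of the function
  \<open>F (A, D) = \<Sum>\<^sub>B \<Phi> (A B; 0 D)\<close>, so on pure tensors the equations of \<open>\<pi>\<^sub>1\<close> and \<open>\<pi>\<^sub>2\<close> can be applied
  one block at a time.  A functional on \<open>W\<^sub>1 / W\<^sub>2\<close> is pulled back to \<open>W\<^sub>1\<close> and extended to the whole
  induced module by hypothesis, so the equation passes to the subquotient.
\<close>

section \<open>Matrices over a finite field\<close>

text \<open>A functional on a tensor product need not be a sum of products of functionals on the
  factors. It is used as a bilinear form with one argument frozen at a time, which suffices because
  the equations of \<open>\<pi>1\<close> and \<open>\<pi>2\<close> hold for every functional. The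
  power \<open>q ^ (n1 * n2)\<close> in the compatibility of the square roots is the order of the
  unipotent radical: summing the character over it kills every nonzero lower left block and
  multiplies the surviving term by this order. The weak form runs through the same argument because
  a block triangular matrix is invertible exactly when its diagonal blocks are, so the sum over the
  upper right block of a function supported on invertible matrices is supported on pairs of
  invertible blocks. Over a general ring a functional on a submodule need not extend, hence the
  hypothesis on restriction.\<close>

lemma bij_betw_mat_funcset:
  "bij_betw (\<lambda>A. \<lambda>ij\<in>{..<nr} \<times> {..<nc}. A $$ ij) (carrier_mat nr nc)
     ({..<nr} \<times> {..<nc} \<rightarrow>\<^sub>E (UNIV :: 'a set))"
  by (rule bij_betw_byWitness[where f' = "\<lambda>f. mat nr nc f"])
    (auto simp: PiE_def extensional_def fun_eq_iff)

lemma finite_carrier_mat [simp]: "finite (carrier_mat nr nc :: 'a::finite mat set)"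
  using bij_betw_finite[OF bij_betw_mat_funcset[where 'a = 'a, of nr nc]] by (simp add: finite_PiE)

lemma card_carrier_mat:
  "card (carrier_mat nr nc :: 'a::finite mat set) = card (UNIV :: 'a set) ^ (nr * nc)"
  using bij_betw_same_card[OF bij_betw_mat_funcset[where 'a = 'a, of nr nc]]
  by (simp add: card_PiE card_cartesian_product)

section \<open>Traces and block decompositions\<close>

lemma mat_trace_add:
  assumes "A \<in> carrier_mat n n" "B \<in> carrier_mat n n"
  shows "mat_trace (A + B) = mat_trace A + (mat_trace B :: 'a::comm_monoid_add)"
  using assms by (auto simp: mat_trace_def sum.distrib[symmetric])

lemma mat_trace_mult:
  assumes "A \<in> carrier_mat n m" "B \<in> carrier_mat m n"
  shows "mat_trace (A * B) = (\<Sum>i<n. \<Sum>j<m. A $$ (i, j) * (B $$ (j, i) :: 'a::comm_semiring_0))"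
  using assms by (auto simp: mat_trace_def scalar_prod_def atLeast0LessThan)

lemma mat_trace_mult_comm:
  assumes "A \<in> carrier_mat n m" "B \<in> carrier_mat m n"
  shows "mat_trace (A * B) = (mat_trace (B * A) :: 'a::comm_semiring_0)"
  unfolding mat_trace_mult[OF assms] mat_trace_mult[OF assms(2,1)]
  by (subst sum.swap) (simp add: mult.commute)

lemma mat_trace_four_block:
  assumes "A \<in> carrier_mat n1 n1" "D \<in> carrier_mat n2 n2"
  shows "mat_trace (four_block_mat A B C D) = mat_trace A + (mat_trace D :: 'a::comm_monoid_add)"
proof -
  have split: "(\<Sum>i<n1 + n2. f i) = (\<Sum>i<n1. f i) + (\<Sum>i<n2. f (n1 + i))" for f :: "nat \<Rightarrow> 'a"
    by (induction n2) (simp_all add: add.assoc)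
  show ?thesis
    using assms by (simp add: mat_trace_def split)
qed

lemma split_block_four_block_mat:
  assumes "A \<in> carrier_mat n1 m1" "B \<in> carrier_mat n1 m2" "C \<in> carrier_mat n2 m1" "D \<in> carrier_mat n2 m2"
  shows "split_block (four_block_mat A B C D) n1 m1 = (A, B, C, D)"
  using assms by (auto simp: split_block_def Let_def intro!: eq_matI)

text \<open>Cutting into blocks is a bijection; this lets a Fourier sum over all matrices be
  rearranged block by block.\<close>

lemma sum_four_block_mat:
  fixes f :: "'a::zero mat \<Rightarrow> 'c::comm_monoid_add"
  shows "(\<Sum>M\<in>carrier_mat (n1 + n2) (n1 + n2). f M) =
   (\<Sum>A\<in>carrier_mat n1 n1. \<Sum>B\<in>carrier_mat n1 n2. \<Sum>C\<in>carrier_mat n2 n1.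
      \<Sum>D\<in>carrier_mat n2 n2. f (four_block_mat A B C D))"
proof -
  let ?S = "carrier_mat n1 n1 \<times> carrier_mat n1 n2 \<times> carrier_mat n2 n1 \<times> carrier_mat n2 n2"
  let ?h = "\<lambda>(A, B, C, D). four_block_mat A B C D :: 'a mat"
  have "inj_on ?h ?S"
    by (rule inj_on_inverseI[where g = "\<lambda>M. split_block M n1 n1"])
      (auto simp: split_block_four_block_mat)
  moreover have "carrier_mat (n1 + n2) (n1 + n2) = ?h ` ?S"
  proof (intro equalityI subsetI)
    fix M :: "'a mat" assume M: "M \<in> carrier_mat (n1 + n2) (n1 + n2)"
    obtain A B C D where s: "split_block M n1 n1 = (A, B, C, D)"
      by (metis prod_cases4)
    from split_block[OF s, of n2 n2] M show "M \<in> ?h ` ?S"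
      by (intro image_eqI[of _ _ "(A, B, C, D)"]) auto
  qed auto
  ultimately have "sum f (carrier_mat (n1 + n2) (n1 + n2)) = sum (f \<circ> ?h) ?S"
    by (simp only: sum.reindex)
  then show ?thesis
    by (simp add: sum.cartesian_product split_def o_def)
qed

section \<open>General linear groups\<close>

lemma carrier_GL: "carrier (GL m) = {g \<in> carrier_mat m m. det g \<noteq> (0::'k::field)}"
proof -
  have "g \<in> carrier_mat m m" if "g \<in> Units (ring_mat TYPE('k) m ())" for g
    using that by (simp add: Units_def ring_mat_simps)
  then show ?thesis
    unfolding GL_def units_of_carrier
    by (auto dest: unit_imp_det_non_zero intro: det_non_zero_imp_unit)
qed

lemma GL_carrier_mat [simp]: "g \<in> carrier (GL m) \<Longrightarrow> g \<in> carrier_mat m m"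
  unfolding carrier_GL by simp

lemma GL_simps [simp]: "x \<otimes>\<^bsub>GL m\<^esub> y = x * y" "\<one>\<^bsub>GL m\<^esub> = 1\<^sub>m m"
  by (simp_all add: GL_def units_of_def ring_mat_simps)

lemma group_GL: "group (GL m :: 'k::field mat monoid)"
proof -
  interpret ring "ring_mat TYPE('k) m ()" by (rule ring_mat)
  show ?thesis unfolding GL_def by (rule units_group)
qed

lemma finite_GL [simp]: "finite (carrier (GL m :: 'k::{field,finite} mat monoid))"
  by (rule finite_subset[of _ "carrier_mat m m"]) auto

lemma GL_inv:
  assumes "g \<in> carrier (GL m)"
  shows "inv\<^bsub>GL m\<^esub> g \<in> carrier (GL m)" "inv\<^bsub>GL m\<^esub> g * g = (1\<^sub>m m :: 'k::field mat)"
    "g * inv\<^bsub>GL m\<^esub> g = 1\<^sub>m m"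
  using group.inv_closed[OF group_GL assms] group.l_inv[OF group_GL assms]
    group.r_inv[OF group_GL assms] by simp_all

text \<open>Cancellation is needed against singular and rectangular matrices, which lie outside the
  group, so the group laws alone do not give it.\<close>

lemma GL_inv_mult:
  assumes "g \<in> carrier (GL m)" "a \<in> carrier_mat m r"
  shows "inv\<^bsub>GL m\<^esub> g * (g * a) = (a :: 'k::field mat)" "g * (inv\<^bsub>GL m\<^esub> g * a) = a"
proof -
  note c = GL_carrier_mat[OF GL_inv(1)[OF assms(1)]] GL_carrier_mat[OF assms(1)]
  show "inv\<^bsub>GL m\<^esub> g * (g * a) = a" "g * (inv\<^bsub>GL m\<^esub> g * a) = a"
    unfolding assoc_mult_mat[OF c(1,2) assms(2), symmetric] assoc_mult_mat[OF c(2,1) assms(2), symmetric]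
      GL_inv(2,3)[OF assms(1)] by (rule left_mult_one_mat[OF assms(2)])+
qed

lemma GL_mult_inv:
  assumes "g \<in> carrier (GL m)" "a \<in> carrier_mat r m"
  shows "a * g * inv\<^bsub>GL m\<^esub> g = (a :: 'k::field mat)" "a * inv\<^bsub>GL m\<^esub> g * g = a"
proof -
  note c = GL_carrier_mat[OF GL_inv(1)[OF assms(1)]] GL_carrier_mat[OF assms(1)]
  show "a * g * inv\<^bsub>GL m\<^esub> g = a" "a * inv\<^bsub>GL m\<^esub> g * g = a"
    unfolding assoc_mult_mat[OF assms(2) c(1,2)] assoc_mult_mat[OF assms(2) c(2,1)]
      GL_inv(2,3)[OF assms(1)] by (rule right_mult_one_mat[OF assms(2)])+
qed

section \<open>Block triangular matrices and the parabolic subgroup\<close>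

lemma block_triangular_in_GL_iff:
  assumes "a \<in> carrier_mat n1 n1" "b \<in> carrier_mat n1 n2" "d \<in> carrier_mat n2 n2"
  shows "four_block_mat a b (0\<^sub>m n2 n1) d \<in> carrier (GL (n1 + n2)) \<longleftrightarrow>
    a \<in> carrier (GL n1) \<and> d \<in> carrier (GL n2)"
  unfolding carrier_GL using assms by (simp add: det_four_block_mat_lower_left_zero[OF assms(1,2) refl assms(3)])

lemma block_triangular_mult:
  assumes "a \<in> carrier_mat n1 n1" "b \<in> carrier_mat n1 n2" "d \<in> carrier_mat n2 n2"
    and "a' \<in> carrier_mat n1 n1" "b' \<in> carrier_mat n1 n2" "d' \<in> carrier_mat n2 n2"
  shows "four_block_mat a b (0\<^sub>m n2 n1) d * four_block_mat a' b' (0\<^sub>m n2 n1) d' =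
    four_block_mat (a * a') (a * b' + b * d') (0\<^sub>m n2 n1) (d * d' :: 'a::ring_1 mat)"
proof -
  have z: "0\<^sub>m n2 n1 \<in> carrier_mat n2 n1" by simp
  have "a * a' \<in> carrier_mat n1 n1" "d * d' \<in> carrier_mat n2 n2"
    using assms by (meson mult_carrier_mat)+
  then show ?thesis
    using assms(5) by (simp add: mult_four_block_mat[OF assms(1,2) z assms(3,4,5) z assms(6)]
        left_mult_zero_mat[OF assms(4)] left_mult_zero_mat[OF assms(5)] right_mult_zero_mat[OF assms(2)]
        right_mult_zero_mat[OF assms(3)])
qed

lemma add_uminus_mat:
  assumes "A \<in> carrier_mat nr nc"
  shows "A + - A = (0\<^sub>m nr nc :: 'a::ab_group_add mat)"
  using assms by (intro eq_matI) auto

text \<open>The upper right block is forced by requiring the off-diagonal block of the product to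
  vanish. On the diagonal, inversion acts on each block separately; this is how the inverse in the
  functional equation reaches \<open>\<pi>1\<close> and \<open>\<pi>2\<close>.\<close>

lemma block_triangular_inv:
  fixes a :: "'k::field mat"
  assumes "a \<in> carrier (GL n1)" "b \<in> carrier_mat n1 n2" "d \<in> carrier (GL n2)"
  shows "inv\<^bsub>GL (n1 + n2)\<^esub> four_block_mat a b (0\<^sub>m n2 n1) d =
    four_block_mat (inv\<^bsub>GL n1\<^esub> a) (- (inv\<^bsub>GL n1\<^esub> a * b * inv\<^bsub>GL n2\<^esub> d)) (0\<^sub>m n2 n1) (inv\<^bsub>GL n2\<^esub> d)"
proof -
  interpret G: group "GL (n1 + n2) :: 'k mat monoid" by (rule group_GL)
  interpret G1: group "GL n1 :: 'k mat monoid" by (rule group_GL)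
  interpret G2: group "GL n2 :: 'k mat monoid" by (rule group_GL)
  let ?a = "inv\<^bsub>GL n1\<^esub> a" and ?d = "inv\<^bsub>GL n2\<^esub> d"
  have c: "?a \<in> carrier_mat n1 n1" "?d \<in> carrier_mat n2 n2"
    "a \<in> carrier_mat n1 n1" "d \<in> carrier_mat n2 n2"
    using assms by auto
  have ab: "?a * b \<in> carrier_mat n1 n2" "?a * b * ?d \<in> carrier_mat n1 n2"
    using c assms(2) by (meson mult_carrier_mat)+
  then have z: "- (?a * b * ?d) \<in> carrier_mat n1 n2" by simp
  have "?a * b + - (?a * b * ?d) * d = 0\<^sub>m n1 n2"
  proof -
    have "- (?a * b * ?d) * d = - (?a * b * ?d * d)"
      using c ab by (intro uminus_mult_left_mat) auto
    also have "?a * b * ?d * d = ?a * b"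
      by (rule GL_mult_inv(2)[OF assms(3) mult_carrier_mat[OF c(1) assms(2)]])
    finally show ?thesis
      using ab(1) add_uminus_mat by simp
  qed
  moreover have "?a * a = 1\<^sub>m n1" "?d * d = 1\<^sub>m n2"
    using G1.l_inv[OF assms(1)] G2.l_inv[OF assms(3)] by simp_all
  ultimately have "four_block_mat ?a (- (?a * b * ?d)) (0\<^sub>m n2 n1) ?d * four_block_mat a b (0\<^sub>m n2 n1) d
    = \<one>\<^bsub>GL (n1 + n2)\<^esub>"
    by (simp add: block_triangular_mult[OF c(1) z c(2) c(3) assms(2) c(4)])
  then show ?thesis
    using assms c z by (intro G.inv_equality) (simp_all only: GL_simps block_triangular_in_GL_iff GL_inv)
qed

text \<open>The unipotent block \<open>b\<close> is summed innermost because the inflated action is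
  constant in it, so that this sum falls on the Fourier transform alone.\<close>

lemma sum_parabolic:
  fixes f :: "'k::field mat \<Rightarrow> 'c::comm_monoid_add"
  shows "(\<Sum>p\<in>parabolic n1 n2. f p) =
    (\<Sum>a\<in>carrier (GL n1). \<Sum>d\<in>carrier (GL n2). \<Sum>b\<in>carrier_mat n1 n2. f (four_block_mat a b (0\<^sub>m n2 n1) d))"
proof -
  let ?S = "carrier (GL n1) \<times> carrier (GL n2) \<times> carrier_mat n1 n2"
  let ?h = "\<lambda>(a, d, b). four_block_mat a b (0\<^sub>m n2 n1) d :: 'k mat"
  have "inj_on ?h ?S"
    by (rule inj_on_inverseI[where g = "\<lambda>M. case split_block M n1 n1 of (a, b, c, d) \<Rightarrow> (a, d, b)"])
      (auto simp: split_block_four_block_mat[of _ n1 n1 _ n2 _ n2])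
  moreover have "parabolic n1 n2 = ?h ` ?S"
    by (force simp: parabolic_def)
  ultimately have "sum f (parabolic n1 n2) = sum (f \<circ> ?h) ?S"
    by (simp only: sum.reindex)
  then show ?thesis
    by (simp add: sum.cartesian_product split_def o_def)
qed

lemma subgroup_parabolic: "subgroup (parabolic n1 n2 :: 'k::field mat set) (GL (n1 + n2))"
proof -
  interpret G: group "GL (n1 + n2) :: 'k mat monoid" by (rule group_GL)
  interpret G1: group "GL n1 :: 'k mat monoid" by (rule group_GL)
  interpret G2: group "GL n2 :: 'k mat monoid" by (rule group_GL)
  show ?thesis
  proof (rule G.subgroupI)
    show "(parabolic n1 n2 :: 'k mat set) \<subseteq> carrier (GL (n1 + n2))"
      by (auto simp: parabolic_def block_triangular_in_GL_iff)
    show "(parabolic n1 n2 :: 'k mat set) \<noteq> {}"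
      using G1.one_closed G2.one_closed zero_carrier_mat[of n1 n2] unfolding parabolic_def by blast
  next
    fix p :: "'k mat" assume "p \<in> parabolic n1 n2"
    then obtain a b d where p: "p = four_block_mat a b (0\<^sub>m n2 n1) d"
      "a \<in> carrier (GL n1)" "b \<in> carrier_mat n1 n2" "d \<in> carrier (GL n2)"
      unfolding parabolic_def by blast
    have "- (inv\<^bsub>GL n1\<^esub> a * b * inv\<^bsub>GL n2\<^esub> d) \<in> carrier_mat n1 n2"
      using p(3) G1.inv_closed[OF p(2)] G2.inv_closed[OF p(4)]
      by (meson GL_carrier_mat mult_carrier_mat uminus_carrier_iff_mat)
    then show "inv\<^bsub>GL (n1 + n2)\<^esub> p \<in> parabolic n1 n2"
      unfolding p(1) block_triangular_inv[OF p(2-4)] parabolic_def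
      using G1.inv_closed[OF p(2)] G2.inv_closed[OF p(4)] by blast
  next
    fix p p' :: "'k mat" assume "p \<in> parabolic n1 n2" "p' \<in> parabolic n1 n2"
    then obtain a b d a' b' d' where p: "p = four_block_mat a b (0\<^sub>m n2 n1) d"
      "a \<in> carrier (GL n1)" "b \<in> carrier_mat n1 n2" "d \<in> carrier (GL n2)"
      and p': "p' = four_block_mat a' b' (0\<^sub>m n2 n1) d'"
      "a' \<in> carrier (GL n1)" "b' \<in> carrier_mat n1 n2" "d' \<in> carrier (GL n2)"
      unfolding parabolic_def by blast
    have "p * p' = four_block_mat (a * a') (a * b' + b * d') (0\<^sub>m n2 n1) (d * d')"
      unfolding p p' using p(2-4) p'(2-4) by (intro block_triangular_mult) auto
    moreover have "a * a' \<in> carrier (GL n1)" "d * d' \<in> carrier (GL n2)"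
      using G1.m_closed[OF p(2) p'(2)] G2.m_closed[OF p(4) p'(4)] by auto
    moreover have "a * b' + b * d' \<in> carrier_mat n1 n2"
      using p(2-4) p'(2-4) by auto
    ultimately have "p * p' \<in> parabolic n1 n2"
      unfolding parabolic_def by blast
    then show "p \<otimes>\<^bsub>GL (n1 + n2)\<^esub> p' \<in> parabolic n1 n2"
      by simp
  qed
qed

section \<open>Spectral characters and the Fourier transform\<close>

lemma zero_in_generate_ring: "0 \<in> generate_ring (class_ring :: complex ring) H"
  using ring.zero_in_generate[OF class_ring.ring_axioms, of H] by simp

lemma cyclotomic_ring_hom:
  assumes "\<phi> \<in> Ring.ring_hom (cyclotomic_ring p) (class_ring :: 'r::comm_ring_1 ring)"
  defines "C \<equiv> generate_ring class_ring (roots_of_unity p)"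
  shows "z \<in> C \<Longrightarrow> w \<in> C \<Longrightarrow> \<phi> (z + w) = \<phi> z + \<phi> w"
    and "z \<in> C \<Longrightarrow> w \<in> C \<Longrightarrow> \<phi> (z * w) = \<phi> z * \<phi> w"
    and "\<phi> 0 = 0" and "\<phi> 1 = 1"
proof -
  show add: "\<phi> (z + w) = \<phi> z + \<phi> w" if "z \<in> C" "w \<in> C" for z w
    using ring_hom_add[OF assms(1), of z w] that by (simp add: cyclotomic_ring_def C_def)
  show "z \<in> C \<Longrightarrow> w \<in> C \<Longrightarrow> \<phi> (z * w) = \<phi> z * \<phi> w"
    using ring_hom_mult[OF assms(1), of z w] by (simp add: cyclotomic_ring_def C_def)
  show "\<phi> 1 = 1"
    using ring_hom_one[OF assms(1)] by (simp add: cyclotomic_ring_def)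
  have "0 \<in> C"
    unfolding C_def by (rule zero_in_generate_ring)
  from add[OF this this] show "\<phi> 0 = 0" by simp
qed

lemma cyclotomic_ring_hom_sum:
  assumes "\<phi> \<in> Ring.ring_hom (cyclotomic_ring p) (class_ring :: 'r::comm_ring_1 ring)"
    and "\<And>x. x \<in> X \<Longrightarrow> f x \<in> generate_ring class_ring (roots_of_unity p)"
  shows "\<phi> (\<Sum>x\<in>X. f x) = (\<Sum>x\<in>X. \<phi> (f x))"
proof -
  let ?C = "generate_ring class_ring (roots_of_unity p)"
  \<comment> \<open>Membership is carried along in the induction, since \<open>\<phi>\<close> is
    known to be additive only on the subring.\<close>
  have "(\<Sum>x\<in>X. f x) \<in> ?C \<and> \<phi> (\<Sum>x\<in>X. f x) = (\<Sum>x\<in>X. \<phi> (f x))"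
    using assms(2)
  proof (induction X rule: infinite_finite_induct)
    case (insert x F)
    then have "f x \<in> ?C" "(\<Sum>x\<in>F. f x) \<in> ?C" by auto
    from generate_ring.eng_add[OF this] cyclotomic_ring_hom(1)[OF assms(1) this] show ?case
      using insert by simp
  qed (use zero_in_generate_ring cyclotomic_ring_hom(3)[OF assms(1)] in auto)
  then show ?thesis ..
qed

lemma spectral_character_add:
  fixes \<psi> :: "'k::finite_field \<Rightarrow> 'r::comm_ring_1"
  assumes "\<phi> \<in> Ring.ring_hom (cyclotomic_ring CHAR('k)) class_ring"
    and "nontrivial_spectral_character \<phi> \<psi>"
  shows "\<psi> (x + y) = \<psi> x * \<psi> y"
proof -
  obtain \<chi> where \<chi>: "\<forall>x. \<chi> x \<in> roots_of_unity CHAR('k)" "\<forall>x y. \<chi> (x + y) = \<chi> x * \<chi> y" "\<psi> = \<phi> \<circ> \<chi>"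
    using assms(2) unfolding nontrivial_spectral_character_def by blast
  then show ?thesis
    by (simp add: cyclotomic_ring_hom(2)[OF assms(1)] generate_ring.incl)
qed

lemma spectral_character_0:
  fixes \<psi> :: "'k::finite_field \<Rightarrow> 'r::comm_ring_1"
  assumes "\<phi> \<in> Ring.ring_hom (cyclotomic_ring CHAR('k)) class_ring"
    and "nontrivial_spectral_character \<phi> \<psi>"
  shows "\<psi> 0 = 1"
proof -
  obtain \<chi> where \<chi>: "\<forall>x. \<chi> x \<in> roots_of_unity CHAR('k)" "\<forall>x y. \<chi> (x + y) = \<chi> x * \<chi> y" "\<psi> = \<phi> \<circ> \<chi>"
    using assms(2) unfolding nontrivial_spectral_character_def by blast
  have "\<chi> 0 * \<chi> 0 = \<chi> 0" using \<chi>(2) by (metis add_0)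
  \<comment> \<open>Zero would be a root of unity only for the exponent 0, and a finite field has
    positive characteristic.\<close>
  moreover have "\<chi> 0 \<noteq> 0"
    using \<chi>(1) finite_imp_CHAR_pos[where 'a = 'k] by (auto simp: roots_of_unity_def zero_power dest!: spec[of _ 0])
  ultimately show ?thesis
    using \<chi>(3) cyclotomic_ring_hom(4)[OF assms(1)] by simp
qed

text \<open>Orthogonality is proved in the complex numbers, since \<open>\<psi> x - 1\<close> may be a zero divisor in \<open>'r\<close>.\<close>

lemma sum_spectral_character_trace:
  fixes \<psi> :: "'k::finite_field \<Rightarrow> 'r::comm_ring_1"
  assumes "\<phi> \<in> Ring.ring_hom (cyclotomic_ring CHAR('k)) class_ring"
    and "nontrivial_spectral_character \<phi> \<psi>"
    and C: "C \<in> carrier_mat n2 n1"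
  shows "(\<Sum>b\<in>carrier_mat n1 n2. \<psi> (mat_trace (C * b))) =
    (if C = 0\<^sub>m n2 n1 then of_nat (card (UNIV :: 'k set) ^ (n1 * n2)) else 0)"
proof (cases "C = 0\<^sub>m n2 n1")
  case True
  have "mat_trace (C * b) = 0" if "b \<in> carrier_mat n1 n2" for b
    using that True by (simp add: mat_trace_def)
  then show ?thesis
    using True by (simp add: spectral_character_0[OF assms(1,2)] card_carrier_mat)
next
  case False
  obtain \<chi> where \<chi>: "\<forall>x. \<chi> x \<in> roots_of_unity CHAR('k)" "\<And>x y. \<chi> (x + y) = \<chi> x * \<chi> y" "\<exists>x. \<chi> x \<noteq> 1"
    and \<psi>: "\<psi> = \<phi> \<circ> \<chi>"
    using assms(2) unfolding nontrivial_spectral_character_def by blast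
  from \<chi>(3) obtain x where x: "\<chi> x \<noteq> 1" ..
  obtain i j where ij: "i < n2" "j < n1" "C $$ (i, j) \<noteq> 0"
    using False C by (metis carrier_matD eq_matI index_zero_mat)
  \<comment> \<open>A scaled elementary matrix at the transposed position of a nonzero entry of
    \<open>C\<close>, chosen so that the trace of \<open>C * b0\<close> is \<open>x\<close>.\<close>
  define b0 where "b0 = mat n1 n2 (\<lambda>(r, s). if r = j then if s = i then x / C $$ (i, j) else 0 else 0)"
  have b0: "b0 \<in> carrier_mat n1 n2" by (simp add: b0_def)
  have "(\<Sum>i'<n2. \<Sum>j'<n1. C $$ (i', j') * b0 $$ (j', i')) =
      (\<Sum>i'<n2. \<Sum>j'<n1. if j' = j then if i' = i then x else 0 else 0)"
    using ij by (intro sum.cong refl) (auto simp: b0_def)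
  also have "\<dots> = x"
    using ij by (simp add: sum.delta)
  finally have tr: "mat_trace (C * b0) = x"
    by (simp add: mat_trace_mult[OF C b0])
  let ?S = "\<Sum>b\<in>carrier_mat n1 n2. \<chi> (mat_trace (C * b))"
  \<comment> \<open>Translation by \<open>b0\<close> permutes the matrices and multiplies the sum by
    \<open>\<chi> x\<close>, which is not 1; in the field of complex numbers the sum must be
    0.\<close>
  have "?S = (\<Sum>b\<in>carrier_mat n1 n2. \<chi> (mat_trace (C * (b + b0))))"
    by (rule sum.reindex_bij_witness[where j = "\<lambda>b. b - b0" and i = "\<lambda>b. b + b0"])
      (use b0 in \<open>auto intro!: eq_matI arg_cong[where f = "\<lambda>b. \<chi> (mat_trace (C * b))"]\<close>)
  also have "\<dots> = (\<Sum>b\<in>carrier_mat n1 n2. \<chi> (mat_trace (C * b)) * \<chi> x)"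
  proof (intro sum.cong refl)
    fix b :: "'k mat" assume b: "b \<in> carrier_mat n1 n2"
    have "mat_trace (C * (b + b0)) = mat_trace (C * b) + x"
      unfolding mult_add_distrib_mat[OF C b b0] using C b b0
      by (subst mat_trace_add[of _ n2]) (auto simp: tr)
    then show "\<chi> (mat_trace (C * (b + b0))) = \<chi> (mat_trace (C * b)) * \<chi> x"
      by (simp add: \<chi>(2))
  qed
  also have "\<dots> = ?S * \<chi> x" by (simp add: sum_distrib_right)
  finally have "?S = 0" using x by simp
  \<comment> \<open>Only the finished identity is transported: all summands lie in the subring on
    which \<open>\<phi>\<close> is additive.\<close>
  then have "\<phi> ?S = 0" by (simp add: cyclotomic_ring_hom(3)[OF assms(1)])
  moreover have "\<phi> ?S = (\<Sum>b\<in>carrier_mat n1 n2. \<psi> (mat_trace (C * b)))"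
    using \<chi>(1) by (subst cyclotomic_ring_hom_sum[OF assms(1)]) (auto simp: \<psi> generate_ring.incl)
  ultimately show ?thesis using False by simp
qed

text \<open>Substituting \<open>x * g * k\<inverse>\<close> for \<open>g\<close> permutes all
  matrices, and cyclicity of the trace moves the translations to the other argument with their sides
  exchanged. It matches translates of \<open>\<Phi>\<close> to the coset coordinates of the Fourier
  side.\<close>

lemma fourier_translate:
  fixes \<Phi> :: "'k::finite_field mat \<Rightarrow> 'r::comm_ring_1"
  assumes x: "x \<in> carrier (GL m)" and k: "k \<in> carrier (GL m)" and a: "a \<in> carrier_mat m m"
  shows "fourier s \<psi> m (\<lambda>g. \<Phi> (inv\<^bsub>GL m\<^esub> x * g * k)) a = fourier s \<psi> m \<Phi> (inv\<^bsub>GL m\<^esub> k * a * x)"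
proof -
  let ?x = "inv\<^bsub>GL m\<^esub> x" and ?k = "inv\<^bsub>GL m\<^esub> k"
  note c = GL_carrier_mat[OF x] GL_carrier_mat[OF k] GL_carrier_mat[OF GL_inv(1)[OF x]]
    GL_carrier_mat[OF GL_inv(1)[OF k]]
  note [simp] = mult_carrier_mat[of _ m m _ m] assoc_mult_mat[of _ m m _ m _ m]
    GL_inv_mult[OF x, of _ m] GL_inv_mult[OF k, of _ m] c
    GL_inv[OF x] GL_inv[OF k]
  have tr: "mat_trace (g * a) = mat_trace (?x * g * k * (?k * a * x))" if g: "g \<in> carrier_mat m m" for g
  proof -
    have "?x * g * k * (?k * a * x) = ?x * (g * (a * x))"
      using g a by simp
    then have "mat_trace (?x * g * k * (?k * a * x)) = mat_trace (g * (a * x) * ?x)"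
      using g a by (simp add: mat_trace_mult_comm[of ?x m m] del: assoc_mult_mat)
    also have "g * (a * x) * ?x = g * a"
      using g a by simp
    finally show ?thesis ..
  qed
  have "(\<Sum>g\<in>carrier_mat m m. \<Phi> (?x * g * k) * \<psi> (mat_trace (g * a))) =
    (\<Sum>g\<in>carrier_mat m m. \<Phi> g * \<psi> (mat_trace (g * (?k * a * x))))"
  proof (rule sum.reindex_bij_witness[where j = "\<lambda>g. ?x * g * k" and i = "\<lambda>g. x * g * ?k"])
    fix g :: "'k mat" assume g: "g \<in> carrier_mat m m"
    show "\<Phi> (?x * g * k) * \<psi> (mat_trace (?x * g * k * (?k * a * x))) = \<Phi> (?x * g * k) * \<psi> (mat_trace (g * a))"
      by (simp only: tr[OF g])
  qed simp_all
  then show ?thesis by (simp add: fourier_def)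
qed

text \<open>Integrating over the unipotent radical annihilates the lower left block.\<close>

lemma fourier_parabolic:
  fixes \<psi> :: "'k::finite_field \<Rightarrow> 'r::comm_ring_1" and \<Phi> :: "'k mat \<Rightarrow> 'r"
  assumes \<phi>: "\<phi> \<in> Ring.ring_hom (cyclotomic_ring CHAR('k)) class_ring"
    and \<psi>: "nontrivial_spectral_character \<phi> \<psi>"
    and s: "inv\<^bsub>class_ring\<^esub> s * of_nat (card (UNIV :: 'k set) ^ (n1 * n2)) =
      inv\<^bsub>class_ring\<^esub> s1 * inv\<^bsub>class_ring\<^esub> s2"
    and a: "a \<in> carrier_mat n1 n1" and d: "d \<in> carrier_mat n2 n2"
  shows "(\<Sum>b\<in>carrier_mat n1 n2. fourier s \<psi> (n1 + n2) \<Phi> (four_block_mat a b (0\<^sub>m n2 n1) d)) =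
    fourier s1 \<psi> n1 (\<lambda>A. fourier s2 \<psi> n2
      (\<lambda>D. \<Sum>B\<in>carrier_mat n1 n2. \<Phi> (four_block_mat A B (0\<^sub>m n2 n1) D)) d) a"
proof -
  let ?M1 = "carrier_mat n1 n1 :: 'k mat set" and ?M2 = "carrier_mat n2 n2 :: 'k mat set"
  let ?N = "carrier_mat n1 n2 :: 'k mat set" and ?N' = "carrier_mat n2 n1 :: 'k mat set"
  let ?z = "0\<^sub>m n2 n1 :: 'k mat"
  let ?q = "of_nat (card (UNIV :: 'k set) ^ (n1 * n2)) :: 'r"
  note add = spectral_character_add[OF \<phi> \<psi>]
  \<comment> \<open>The diagonal blocks of the product are \<open>A * a\<close> and
    \<open>C * b + D * d\<close>: \<open>B\<close> is multiplied by the zero block and leaves the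
    character, while \<open>b\<close> meets only \<open>C\<close>.\<close>
  have tr: "\<psi> (mat_trace (four_block_mat A B C D * four_block_mat a b ?z d)) =
      \<psi> (mat_trace (A * a)) * \<psi> (mat_trace (D * d)) * \<psi> (mat_trace (C * b))"
    if "A \<in> ?M1" "B \<in> ?N" "C \<in> ?N'" "D \<in> ?M2" "b \<in> ?N" for A B C D b
  proof -
    have "A * a + B * ?z = A * a"
      using that a by simp
    then have "mat_trace (four_block_mat A B C D * four_block_mat a b ?z d) =
        mat_trace (A * a) + mat_trace (C * b + D * d)"
      unfolding mult_four_block_mat[OF that(1-4) a that(5) zero_carrier_mat d]
      using that a d by (subst mat_trace_four_block[of _ n1 _ n2]) auto
    also have "mat_trace (C * b + D * d) = mat_trace (C * b) + mat_trace (D * d)"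
      using that d by (intro mat_trace_add[of _ n2]) auto
    finally show ?thesis by (simp add: add mult_ac)
  qed
  have "(\<Sum>b\<in>?N. fourier s \<psi> (n1 + n2) \<Phi> (four_block_mat a b ?z d)) =
    inv\<^bsub>class_ring\<^esub> s * (\<Sum>b\<in>?N. \<Sum>A\<in>?M1. \<Sum>B\<in>?N. \<Sum>C\<in>?N'. \<Sum>D\<in>?M2.
      \<Phi> (four_block_mat A B C D) *
      (\<psi> (mat_trace (A * a)) * \<psi> (mat_trace (D * d)) * \<psi> (mat_trace (C * b))))"
    unfolding fourier_def sum_four_block_mat sum_distrib_left[symmetric]
    by (intro arg_cong2[where f = "(*)"] refl sum.cong) (simp add: tr)
  also have "(\<Sum>b\<in>?N. \<Sum>A\<in>?M1. \<Sum>B\<in>?N. \<Sum>C\<in>?N'. \<Sum>D\<in>?M2.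
      \<Phi> (four_block_mat A B C D) *
      (\<psi> (mat_trace (A * a)) * \<psi> (mat_trace (D * d)) * \<psi> (mat_trace (C * b)))) =
    (\<Sum>A\<in>?M1. \<Sum>B\<in>?N. \<Sum>C\<in>?N'. \<Sum>D\<in>?M2. \<Sum>b\<in>?N.
      \<Phi> (four_block_mat A B C D) *
      (\<psi> (mat_trace (A * a)) * \<psi> (mat_trace (D * d)) * \<psi> (mat_trace (C * b))))"
    by ((rule trans[OF sum.swap], rule sum.cong[OF refl])+) (rule refl)
  \<comment> \<open>With \<open>b\<close> innermost, orthogonality singles out the zero block
    \<open>C\<close> and contributes the order \<open>?q\<close> of the unipotent radical.\<close>
  also have "\<dots> = (\<Sum>A\<in>?M1. \<Sum>B\<in>?N. \<Sum>C\<in>?N'. \<Sum>D\<in>?M2.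
      \<Phi> (four_block_mat A B C D) * (\<psi> (mat_trace (A * a)) * \<psi> (mat_trace (D * d))) *
      (if C = ?z then ?q else 0))"
    by (intro sum.cong refl)
      (simp add: sum_spectral_character_trace[OF \<phi> \<psi>] sum_distrib_left[symmetric] mult.assoc[symmetric]
        del: of_nat_power)
  also have "\<dots> = (\<Sum>A\<in>?M1. \<Sum>B\<in>?N. \<Sum>D\<in>?M2. \<Sum>C\<in>?N'. if C = ?z then
      \<Phi> (four_block_mat A B C D) * (\<psi> (mat_trace (A * a)) * \<psi> (mat_trace (D * d))) * ?q else 0)"
    by (subst (3) sum.swap) (intro sum.cong refl, simp)
  also have "\<dots> = (\<Sum>A\<in>?M1. \<Sum>B\<in>?N. \<Sum>D\<in>?M2.
      \<Phi> (four_block_mat A B ?z D) * (\<psi> (mat_trace (A * a)) * \<psi> (mat_trace (D * d))) * ?q)"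
    by (simp add: sum.delta)
  also have "\<dots> = (\<Sum>A\<in>?M1. \<Sum>D\<in>?M2. \<Sum>B\<in>?N.
      \<Phi> (four_block_mat A B ?z D) * (\<psi> (mat_trace (A * a)) * \<psi> (mat_trace (D * d))) * ?q)"
    by (intro sum.cong refl sum.swap)
  also have "\<dots> = ?q * (\<Sum>A\<in>?M1. \<Sum>D\<in>?M2. (\<Sum>B\<in>?N. \<Phi> (four_block_mat A B ?z D)) *
      \<psi> (mat_trace (D * d)) * \<psi> (mat_trace (A * a)))"
    by (simp add: sum_distrib_left sum_distrib_right mult_ac)
  \<comment> \<open>The factor \<open>?q\<close> is absorbed here: it turns the normalisation for
    the full matrix algebra into the product of those for the two diagonal blocks.\<close>
  also have "inv\<^bsub>class_ring\<^esub> s * \<dots> = inv\<^bsub>class_ring\<^esub> s1 * inv\<^bsub>class_ring\<^esub> s2 *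
    (\<Sum>A\<in>?M1. \<Sum>D\<in>?M2. (\<Sum>B\<in>?N. \<Phi> (four_block_mat A B ?z D)) *
      \<psi> (mat_trace (D * d)) * \<psi> (mat_trace (A * a)))"
    unfolding mult.assoc[symmetric] s ..
  also have "\<dots> = fourier s1 \<psi> n1 (\<lambda>A. fourier s2 \<psi> n2
      (\<lambda>D. \<Sum>B\<in>?N. \<Phi> (four_block_mat A B ?z D)) d) a"
    unfolding fourier_def by (simp add: sum_distrib_left sum_distrib_right mult_ac)
  finally show ?thesis .
qed

section \<open>Quotient modules\<close>

text \<open>Negation is multiplication by \<open>- 1\<close>, so closure under scalars supplies
  additive inverses and the theory of cosets becomes applicable.\<close>

lemma submodule_abelian_subgroup:
  fixes M :: "('r::comm_ring_1, 'v) module"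
  assumes "LinearCombinations.submodule class_ring N M"
  shows "abelian_subgroup N M"
proof -
  interpret N: LinearCombinations.submodule class_ring N M by fact
  interpret M: Module.module class_ring M by (rule N.module)
  have "\<ominus>\<^bsub>M\<^esub> x \<in> N" if "x \<in> N" for x
  proof -
    have "x \<in> carrier M" using that N.subset by auto
    moreover have "- (1::'r) \<odot>\<^bsub>M\<^esub> x \<in> N" using that by (intro N.smult_closed) auto
    ultimately show ?thesis using M.smult_minus_1[of x] by (simp add: class_ring_simps)
  qed
  then have "subgroup N (add_monoid M)"
    using N.subset N.m_closed N.zero_closed
    by (intro M.add.subgroupI) (auto simp: a_inv_def[symmetric] simp del: N.zero_closed)
  then show ?thesis
    by (intro abelian_subgroupI3 additive_subgroup.intro M.abelian_group_axioms)
qed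

lemma carrier_quotient_module:
  "X \<in> carrier (quotient_module M N) \<longleftrightarrow> (\<exists>x\<in>carrier M. X = N +>\<^bsub>M\<^esub> x)"
  by (auto simp: quotient_module_def A_RCOSETS_def')

text \<open>Two representatives differ by an element of \<open>N\<close>, whose image lies in
  \<open>N'\<close>, so the union defining \<open>coset_map\<close> is over equal cosets. Scalar
  multiplication, the tensor action and the subquotient action are all evaluated through
  this.\<close>

lemma coset_map_coset:
  assumes "abelian_subgroup N M" "abelian_subgroup N' M'"
    and h: "h \<in> carrier M \<rightarrow> carrier M'" "h ` N \<subseteq> N'"
    and add: "\<And>x y. x \<in> carrier M \<Longrightarrow> y \<in> carrier M \<Longrightarrow> h (x \<oplus>\<^bsub>M\<^esub> y) = h x \<oplus>\<^bsub>M'\<^esub> h y"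
    and x: "x \<in> carrier M"
  shows "coset_map M' N' h (N +>\<^bsub>M\<^esub> x) = N' +>\<^bsub>M'\<^esub> h x"
proof -
  interpret N: abelian_subgroup N M by fact
  interpret N': abelian_subgroup N' M' by fact
  have "N' +>\<^bsub>M'\<^esub> h y = N' +>\<^bsub>M'\<^esub> h x" if "y \<in> N +>\<^bsub>M\<^esub> x" for y
  proof -
    obtain k where k: "k \<in> N" "y = k \<oplus>\<^bsub>M\<^esub> x"
      using \<open>y \<in> N +>\<^bsub>M\<^esub> x\<close> by (auto simp: a_r_coset_def')
    then have "h y \<in> N' +>\<^bsub>M'\<^esub> h x"
      using add[of k x] x h(2) by (auto simp: a_r_coset_def')
    moreover have "h x \<in> carrier M'" using h(1) x by auto
    ultimately show ?thesis
      using N'.a_repr_independence' by metis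
  qed
  moreover have "x \<in> N +>\<^bsub>M\<^esub> x" using N.a_rcos_self[OF x] .
  ultimately show ?thesis unfolding coset_map_def by blast
qed

context
  fixes M :: "('r::comm_ring_1, 'v) module" and N
  assumes N: "LinearCombinations.submodule class_ring N M"
begin

interpretation N: LinearCombinations.submodule class_ring N M by (rule N)
interpretation M: Module.module class_ring M by (rule N.module)
interpretation N: abelian_subgroup N M by (rule submodule_abelian_subgroup[OF N])

lemma coset_in_quotient: "x \<in> carrier M \<Longrightarrow> N +>\<^bsub>M\<^esub> x \<in> carrier (quotient_module M N)"
  by (auto simp: carrier_quotient_module)

lemma quotient_add:
  "x \<in> carrier M \<Longrightarrow> y \<in> carrier M \<Longrightarrow>
    (N +>\<^bsub>M\<^esub> x) \<oplus>\<^bsub>quotient_module M N\<^esub> (N +>\<^bsub>M\<^esub> y) = N +>\<^bsub>M\<^esub> (x \<oplus>\<^bsub>M\<^esub> y)"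
  by (simp add: quotient_module_def N.a_rcos_sum)

lemma quotient_smult:
  "x \<in> carrier M \<Longrightarrow> r \<odot>\<^bsub>quotient_module M N\<^esub> (N +>\<^bsub>M\<^esub> x) = N +>\<^bsub>M\<^esub> (r \<odot>\<^bsub>M\<^esub> x)"
  unfolding quotient_module_def
  using N.smult_closed M.smult_r_distr
  by (simp add: coset_map_coset[OF N.abelian_subgroup_axioms N.abelian_subgroup_axioms] image_subset_iff)

lemma quotient_zero: "\<zero>\<^bsub>quotient_module M N\<^esub> = N +>\<^bsub>M\<^esub> \<zero>\<^bsub>M\<^esub>"
  by (simp add: quotient_module_def N.a_rcos_const)

lemma coset_eqI:
  assumes "k \<in> N" "y \<in> carrier M" shows "N +>\<^bsub>M\<^esub> (k \<oplus>\<^bsub>M\<^esub> y) = N +>\<^bsub>M\<^esub> y"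
proof -
  have "k \<oplus>\<^bsub>M\<^esub> y \<in> N +>\<^bsub>M\<^esub> y" using assms(1) by (auto simp: a_r_coset_def')
  from N.a_repr_independence'[OF this assms(2)] show ?thesis ..
qed

lemma module_quotient: "Module.module class_ring (quotient_module M N)"
proof (rule module_criteria)
  show "cring (class_ring :: 'r ring)" by (rule class_cring.cring_axioms)
  show "\<forall>v\<in>carrier (quotient_module M N). \<exists>neg_v\<in>carrier (quotient_module M N).
      v \<oplus>\<^bsub>quotient_module M N\<^esub> neg_v = \<zero>\<^bsub>quotient_module M N\<^esub>"
  proof
    fix X assume "X \<in> carrier (quotient_module M N)"
    then obtain x where x: "x \<in> carrier M" "X = N +>\<^bsub>M\<^esub> x" by (auto simp: carrier_quotient_module)
    then show "\<exists>Y\<in>carrier (quotient_module M N). X \<oplus>\<^bsub>quotient_module M N\<^esub> Y = \<zero>\<^bsub>quotient_module M N\<^esub>"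
      by (intro bexI[of _ "N +>\<^bsub>M\<^esub> (\<ominus>\<^bsub>M\<^esub> x)"])
        (simp_all add: quotient_add quotient_zero coset_in_quotient M.r_neg)
  qed
  show "\<zero>\<^bsub>quotient_module M N\<^esub> \<in> carrier (quotient_module M N)"
    by (simp add: quotient_zero coset_in_quotient)
  show "\<forall>X Y. X \<in> carrier (quotient_module M N) \<and> Y \<in> carrier (quotient_module M N) \<longrightarrow>
      X \<oplus>\<^bsub>quotient_module M N\<^esub> Y \<in> carrier (quotient_module M N)"
    by (metis carrier_quotient_module quotient_add M.a_closed)
  show "\<forall>r X. r \<in> carrier class_ring \<and> X \<in> carrier (quotient_module M N) \<longrightarrow>
      r \<odot>\<^bsub>quotient_module M N\<^esub> X \<in> carrier (quotient_module M N)"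
    by (metis carrier_quotient_module quotient_smult M.smult_closed)
  show "\<forall>X Y. X \<in> carrier (quotient_module M N) \<and> Y \<in> carrier (quotient_module M N) \<longrightarrow>
      X \<oplus>\<^bsub>quotient_module M N\<^esub> Y = Y \<oplus>\<^bsub>quotient_module M N\<^esub> X"
    by (auto simp: carrier_quotient_module quotient_add M.a_comm)
qed (auto simp: carrier_quotient_module quotient_add quotient_smult quotient_zero
    M.a_assoc M.smult_l_distr[simplified] M.smult_r_distr[simplified] M.smult_assoc1[simplified]
    M.smult_one[simplified] M.smult_closed[simplified])

end

section \<open>Free modules\<close>

lemma free_module_simps [simp]:
  "\<zero>\<^bsub>free_module S\<^esub> = (\<lambda>_. 0)" "f \<oplus>\<^bsub>free_module S\<^esub> g = (\<lambda>x. f x + g x)"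
  "r \<odot>\<^bsub>free_module S\<^esub> f = (\<lambda>x. r * f x)"
  by (simp_all add: free_module_def)

lemma free_module_add_closed:
  "f \<in> carrier (free_module S) \<Longrightarrow> g \<in> carrier (free_module S) \<Longrightarrow> (\<lambda>x. f x + g x) \<in> carrier (free_module S)"
  by (auto simp: free_module_def intro: finite_subset[of _ "{x. f x \<noteq> 0} \<union> {x. g x \<noteq> 0}"])

lemma free_module_smult_closed:
  "f \<in> carrier (free_module S) \<Longrightarrow> (\<lambda>x. r * f x) \<in> carrier (free_module S)"
  by (auto simp: free_module_def elim: finite_subset[rotated])

lemma free_module_diff_closed:
  assumes "f \<in> carrier (free_module S)" "g \<in> carrier (free_module S)"
  shows "(\<lambda>x. f x - g x) \<in> carrier (free_module S)"
  using free_module_add_closed[OF assms(1) free_module_smult_closed[OF assms(2), of "- 1"]] by simp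

lemma free_gen_closed: "x \<in> S \<Longrightarrow> free_gen x \<in> carrier (free_module S)"
  by (auto simp: free_module_def free_gen_def intro: finite_subset[of _ "{x}"])

lemma module_free: "Module.module class_ring (free_module S :: ('r::comm_ring_1, 's \<Rightarrow> 'r) module)"
proof (rule module_criteria)
  show "cring (class_ring :: 'r ring)" by (rule class_cring.cring_axioms)
  show "\<forall>f\<in>carrier (free_module S :: ('r, 's \<Rightarrow> 'r) module). \<exists>g\<in>carrier (free_module S).
      f \<oplus>\<^bsub>free_module S\<^esub> g = \<zero>\<^bsub>free_module S\<^esub>"
  proof
    fix f :: "'s \<Rightarrow> 'r" assume "f \<in> carrier (free_module S)"
    then show "\<exists>g\<in>carrier (free_module S). f \<oplus>\<^bsub>free_module S\<^esub> g = \<zero>\<^bsub>free_module S\<^esub>"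
      by (intro bexI[of _ "\<lambda>x. - 1 * f x"] free_module_smult_closed) auto
  qed
  show "\<zero>\<^bsub>free_module S\<^esub> \<in> carrier (free_module S :: ('r, 's \<Rightarrow> 'r) module)"
    by (simp add: free_module_def)
qed (auto simp: free_module_add_closed free_module_smult_closed algebra_simps)

text \<open>Finite support allows generators to be removed one by one. The step adds a scalar
  multiple of one generator, the shape that \<open>tensor_induct\<close> inherits.\<close>

lemma free_module_induct [consumes 1, case_names zero add]:
  assumes "f \<in> carrier (free_module S)"
    and "P (\<lambda>_. 0)"
    and "\<And>f r x. f \<in> carrier (free_module S) \<Longrightarrow> P f \<Longrightarrow> x \<in> S \<Longrightarrow> P (\<lambda>z. f z + r * free_gen x z)"
  shows "P f"
proof -
  have "P f" if "finite A" "f \<in> carrier (free_module S)" "{x. f x \<noteq> 0} = A" for A f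
    using that
  proof (induction A arbitrary: f rule: finite_induct)
    case empty
    then have "f = (\<lambda>_. 0)" by auto
    then show ?case using assms(2) by simp
  next
    case (insert a A)
    define g where "g = f(a := 0)"
    have supp: "{x. g x \<noteq> 0} = A"
      using insert by (auto simp: g_def)
    have a: "a \<in> S" using insert.prems by (auto simp: free_module_def)
    have g: "g \<in> carrier (free_module S)"
      using insert.prems(1) supp insert.hyps(1) by (auto simp: free_module_def g_def)
    have "f = (\<lambda>z. g z + f a * free_gen a z)"
      by (auto simp: g_def free_gen_def)
    with assms(3)[OF g insert.IH[OF g supp] a, of "f a"] show ?case by simp
  qed
  from this[OF _ assms(1) refl] assms(1) show ?thesis by (simp add: free_module_def)
qed

text \<open>The index set in \<open>free_map\<close> depends on the support of \<open>f\<close>; a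
  common finite set containing several supports is what makes additivity provable.\<close>

lemma free_map_eq_sum:
  assumes "finite A" "{x. f x \<noteq> 0} \<subseteq> A"
  shows "free_map h f y = (\<Sum>x\<in>A. if h x = y then f x else 0)"
proof -
  have "(\<Sum>x\<in>A. if h x = y then f x else 0) = (\<Sum>x\<in>A \<inter> {x. h x = y}. f x)"
    using assms(1) by (simp add: sum.inter_restrict)
  also have "\<dots> = free_map h f y"
    unfolding free_map_def using assms by (intro sum.mono_neutral_right) auto
  finally show ?thesis ..
qed

lemma free_map_add:
  assumes "f \<in> carrier (free_module S)" "g \<in> carrier (free_module S)"
  shows "free_map h (\<lambda>x. f x + g x) = (\<lambda>y. free_map h f y + free_map h g y)"
proof
  fix y
  let ?A = "{x. f x \<noteq> 0} \<union> {x. g x \<noteq> 0}"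
  have A: "finite ?A" using assms by (auto simp: free_module_def)
  have "free_map h (\<lambda>x. f x + g x) y = (\<Sum>x\<in>?A. if h x = y then f x + g x else 0)"
    by (rule free_map_eq_sum[OF A]) auto
  also have "\<dots> = (\<Sum>x\<in>?A. (if h x = y then f x else 0) + (if h x = y then g x else 0))"
    by (intro sum.cong) simp_all
  also have "\<dots> = free_map h f y + free_map h g y"
    using free_map_eq_sum[OF A, of f h y] free_map_eq_sum[OF A, of g h y] by (simp add: sum.distrib)
  finally show "free_map h (\<lambda>x. f x + g x) y = free_map h f y + free_map h g y" .
qed

lemma free_map_smult:
  assumes "f \<in> carrier (free_module S)"
  shows "free_map h (\<lambda>x. r * f x) = (\<lambda>y. r * free_map h f y)"
proof
  fix y
  have A: "finite {x. f x \<noteq> 0}" using assms by (auto simp: free_module_def)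
  have "free_map h (\<lambda>x. r * f x) y = (\<Sum>x | f x \<noteq> 0. if h x = y then r * f x else 0)"
    by (rule free_map_eq_sum[OF A]) auto
  also have "\<dots> = r * (\<Sum>x | f x \<noteq> 0. if h x = y then f x else 0)"
    unfolding sum_distrib_left by (intro sum.cong) simp_all
  also have "\<dots> = r * free_map h f y"
    using free_map_eq_sum[OF A, of f h y] by simp
  finally show "free_map h (\<lambda>x. r * f x) y = r * free_map h f y" .
qed

lemma free_map_diff:
  assumes "f \<in> carrier (free_module S)" "g \<in> carrier (free_module S)"
  shows "free_map h (\<lambda>x. f x - g x) = (\<lambda>y. free_map h f y - free_map h g y)"
  using free_map_add[OF assms(1) free_module_smult_closed[OF assms(2)], of h "- 1"]
  by (simp add: free_map_smult[OF assms(2), where r = "- 1", simplified])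

lemma free_map_gen: "free_map h (free_gen x) = free_gen (h x)"
proof
  fix y
  show "free_map h (free_gen x) y = (free_gen (h x) :: _ \<Rightarrow> 'r::comm_ring_1) y"
    by (subst free_map_eq_sum[of "{x}"]) (auto simp: free_gen_def)
qed

lemma free_map_0: "free_map h (\<lambda>_. 0) = (\<lambda>_. 0)"
  by (simp add: free_map_def)

lemma free_map_closed:
  assumes "f \<in> carrier (free_module S)" "h \<in> S \<rightarrow> S'"
  shows "free_map h f \<in> carrier (free_module S')"
  using assms(1)
proof (induction rule: free_module_induct)
  case zero
  then show ?case by (simp add: free_map_0 free_module_def)
next
  case (add f r x)
  have "free_gen (h x) \<in> carrier (free_module S')"
    using assms(2) add.hyps(2) by (auto intro: free_gen_closed)
  moreover have "free_map h (\<lambda>z. f z + r * free_gen x z) = (\<lambda>z. free_map h f z + r * free_gen (h x) z)"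
    using add.hyps by (simp add: free_map_add[of _ S] free_map_smult[of _ S] free_gen_closed
        free_module_smult_closed free_map_gen)
  ultimately show ?case
    using add.IH by (simp only:) (intro free_module_add_closed free_module_smult_closed)
qed

section \<open>Linear functionals\<close>

lemma dual_iff:
  "l \<in> dual V \<longleftrightarrow> l \<in> extensional (carrier V) \<and>
    (\<forall>x\<in>carrier V. \<forall>y\<in>carrier V. l (x \<oplus>\<^bsub>V\<^esub> y) = l x + l y) \<and>
    (\<forall>r. \<forall>x\<in>carrier V. l (r \<odot>\<^bsub>V\<^esub> x) = r * l x)"
  by (auto simp: dual_def LinearCombinations.module_hom_def scalar_module_def)

lemma dual_zero:
  assumes "Module.module class_ring V" "l \<in> dual V"
  shows "l \<zero>\<^bsub>V\<^esub> = 0"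
proof -
  interpret Module.module class_ring V by fact
  have "l (0 \<odot>\<^bsub>V\<^esub> \<zero>\<^bsub>V\<^esub>) = 0 * l \<zero>\<^bsub>V\<^esub>"
    using assms(2) M.zero_closed unfolding dual_iff by blast
  moreover have "0 \<odot>\<^bsub>V\<^esub> \<zero>\<^bsub>V\<^esub> = \<zero>\<^bsub>V\<^esub>"
    by (rule smult_r_null) simp
  ultimately show ?thesis by simp
qed

lemma module_hom_zero:
  assumes "Module.module R M" "Module.module R N" "f \<in> LinearCombinations.module_hom R M N"
  shows "f \<zero>\<^bsub>M\<^esub> = \<zero>\<^bsub>N\<^esub>"
  using assms by (intro mod_hom.f0_is_0 mod_hom.intro mod_hom_axioms.intro)

section \<open>Tensor products\<close>

lemma bilinear_relations_cases:
  assumes "r \<in> bilinear_relations V W"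
  obtains v v' w where "v \<in> carrier V" "v' \<in> carrier V" "w \<in> carrier W"
      "r = (\<lambda>z. free_gen (v \<oplus>\<^bsub>V\<^esub> v', w) z - free_gen (v, w) z - free_gen (v', w) z)"
  | v w w' where "v \<in> carrier V" "w \<in> carrier W" "w' \<in> carrier W"
      "r = (\<lambda>z. free_gen (v, w \<oplus>\<^bsub>W\<^esub> w') z - free_gen (v, w) z - free_gen (v, w') z)"
  | c v w where "v \<in> carrier V" "w \<in> carrier W"
      "r = (\<lambda>z. free_gen (c \<odot>\<^bsub>V\<^esub> v, w) z - c * free_gen (v, w) z)"
  | c v w where "v \<in> carrier V" "w \<in> carrier W"
      "r = (\<lambda>z. free_gen (v, c \<odot>\<^bsub>W\<^esub> w) z - c * free_gen (v, w) z)"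
  using assms unfolding bilinear_relations_def by blast

lemma bilinear_relationsI:
  assumes "v \<in> carrier V" "w \<in> carrier W"
  shows "v' \<in> carrier V \<Longrightarrow> (\<lambda>z. free_gen (v \<oplus>\<^bsub>V\<^esub> v', w) z - free_gen (v, w) z - free_gen (v', w) z)
      \<in> bilinear_relations V W"
    and "w' \<in> carrier W \<Longrightarrow> (\<lambda>z. free_gen (v, w \<oplus>\<^bsub>W\<^esub> w') z - free_gen (v, w) z - free_gen (v, w') z)
      \<in> bilinear_relations V W"
    and "(\<lambda>z. free_gen (c \<odot>\<^bsub>V\<^esub> v, w) z - c * free_gen (v, w) z) \<in> bilinear_relations V W"
    and "(\<lambda>z. free_gen (v, c \<odot>\<^bsub>W\<^esub> w) z - c * free_gen (v, w) z) \<in> bilinear_relations V W"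
  using assms unfolding bilinear_relations_def by blast+

definition tensor_class ::
    "('r::comm_ring_1, 'a) module \<Rightarrow> ('r, 'b) module \<Rightarrow> ('a \<times> 'b \<Rightarrow> 'r) \<Rightarrow> ('a \<times> 'b \<Rightarrow> 'r) set" where
  "tensor_class V W f = tensor_kernel V W +>\<^bsub>free_module (carrier V \<times> carrier W)\<^esub> f"

definition pure_tensor ::
    "('r::comm_ring_1, 'a) module \<Rightarrow> ('r, 'b) module \<Rightarrow> 'a \<Rightarrow> 'b \<Rightarrow> ('a \<times> 'b \<Rightarrow> 'r) set" where
  "pure_tensor V W v w = tensor_class V W (free_gen (v, w))"

context
  fixes V :: "('r::comm_ring_1, 'a) module" and W :: "('r, 'b) module"
  assumes V: "Module.module class_ring V" and W: "Module.module class_ring W"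
begin

interpretation V: Module.module class_ring V by (rule V)
interpretation W: Module.module class_ring W by (rule W)

lemma bilinear_relations_subset:
  "bilinear_relations V W \<subseteq> carrier (free_module (carrier V \<times> carrier W))"
proof
  fix r assume "r \<in> bilinear_relations V W"
  then show "r \<in> carrier (free_module (carrier V \<times> carrier W))"
    by (cases rule: bilinear_relations_cases)
      (auto intro!: free_module_diff_closed free_module_smult_closed free_gen_closed
        V.smult_closed[simplified] W.smult_closed[simplified])
qed

lemma submodule_tensor_kernel:
  "LinearCombinations.submodule class_ring (tensor_kernel V W) (free_module (carrier V \<times> carrier W))"
  unfolding tensor_kernel_def by (rule module.span_is_submodule[OF module_free bilinear_relations_subset])

lemma relation_in_tensor_kernel: "r \<in> bilinear_relations V W \<Longrightarrow> r \<in> tensor_kernel V W"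
  unfolding tensor_kernel_def using module.in_own_span[OF module_free bilinear_relations_subset] by blast

lemmas module_tensor = module_quotient[OF submodule_tensor_kernel, folded tensor_module_def]

lemma carrier_tensor_module:
  "X \<in> carrier (tensor_module V W) \<longleftrightarrow>
    (\<exists>f\<in>carrier (free_module (carrier V \<times> carrier W)). X = tensor_class V W f)"
  unfolding tensor_module_def tensor_class_def by (rule carrier_quotient_module)

lemma tensor_class_closed:
  "f \<in> carrier (free_module (carrier V \<times> carrier W)) \<Longrightarrow> tensor_class V W f \<in> carrier (tensor_module V W)"
  by (auto simp: carrier_tensor_module)

lemma tensor_class_add:
  assumes "f \<in> carrier (free_module (carrier V \<times> carrier W))" "g \<in> carrier (free_module (carrier V \<times> carrier W))"
  shows "tensor_class V W f \<oplus>\<^bsub>tensor_module V W\<^esub> tensor_class V W g = tensor_class V W (\<lambda>z. f z + g z)"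
  using quotient_add[OF submodule_tensor_kernel assms] by (simp add: tensor_module_def tensor_class_def)

lemma tensor_class_smult:
  assumes "f \<in> carrier (free_module (carrier V \<times> carrier W))"
  shows "r \<odot>\<^bsub>tensor_module V W\<^esub> tensor_class V W f = tensor_class V W (\<lambda>z. r * f z)"
  using quotient_smult[OF submodule_tensor_kernel assms] by (simp add: tensor_module_def tensor_class_def)

lemma tensor_class_zero: "\<zero>\<^bsub>tensor_module V W\<^esub> = tensor_class V W (\<lambda>_. 0)"
  using quotient_zero[OF submodule_tensor_kernel] by (simp add: tensor_module_def tensor_class_def)

lemma tensor_class_eqI:
  assumes "(\<lambda>z. f z - g z) \<in> bilinear_relations V W" "g \<in> carrier (free_module (carrier V \<times> carrier W))"
  shows "tensor_class V W f = tensor_class V W g"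
  using coset_eqI[OF submodule_tensor_kernel relation_in_tensor_kernel[OF assms(1)] assms(2)]
  by (simp add: tensor_class_def)

lemma pure_tensor_closed:
  "v \<in> carrier V \<Longrightarrow> w \<in> carrier W \<Longrightarrow> pure_tensor V W v w \<in> carrier (tensor_module V W)"
  by (simp add: pure_tensor_def tensor_class_closed free_gen_closed)

text \<open>Each identity is one of the four families of relations that the quotient kills.\<close>

lemma pure_tensor_bilinear:
  assumes v: "v \<in> carrier V" and w: "w \<in> carrier W"
  shows "v' \<in> carrier V \<Longrightarrow> pure_tensor V W (v \<oplus>\<^bsub>V\<^esub> v') w =
      pure_tensor V W v w \<oplus>\<^bsub>tensor_module V W\<^esub> pure_tensor V W v' w"
    and "w' \<in> carrier W \<Longrightarrow> pure_tensor V W v (w \<oplus>\<^bsub>W\<^esub> w') =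
      pure_tensor V W v w \<oplus>\<^bsub>tensor_module V W\<^esub> pure_tensor V W v w'"
    and "pure_tensor V W (c \<odot>\<^bsub>V\<^esub> v) w = c \<odot>\<^bsub>tensor_module V W\<^esub> pure_tensor V W v w"
    and "pure_tensor V W v (c \<odot>\<^bsub>W\<^esub> w) = c \<odot>\<^bsub>tensor_module V W\<^esub> pure_tensor V W v w"
  using bilinear_relationsI[OF v w] v w unfolding pure_tensor_def
  by (simp_all add: tensor_class_add tensor_class_smult free_gen_closed)
    (auto intro!: tensor_class_eqI free_module_add_closed free_module_smult_closed free_gen_closed
      simp: diff_diff_eq)

text \<open>Pure tensors generate the tensor product. This induction stands in for the universal
  property whenever two expressions linear in a tensor have to be compared.\<close>

lemma tensor_induct [consumes 1, case_names zero add]: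
  assumes "X \<in> carrier (tensor_module V W)"
    and "P \<zero>\<^bsub>tensor_module V W\<^esub>"
    and "\<And>X r v w. X \<in> carrier (tensor_module V W) \<Longrightarrow> P X \<Longrightarrow> v \<in> carrier V \<Longrightarrow> w \<in> carrier W \<Longrightarrow>
      P (X \<oplus>\<^bsub>tensor_module V W\<^esub> r \<odot>\<^bsub>tensor_module V W\<^esub> pure_tensor V W v w)"
  shows "P X"
proof -
  obtain f where f: "f \<in> carrier (free_module (carrier V \<times> carrier W))" "X = tensor_class V W f"
    using assms(1) carrier_tensor_module by blast
  have "P (tensor_class V W f)"
    using f(1)
  proof (induction rule: free_module_induct)
    case zero
    then show ?case using assms(2) by (simp add: tensor_class_zero)
  next
    case (add f r x)
    obtain v w where x: "x = (v, w)" "v \<in> carrier V" "w \<in> carrier W"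
      using add.hyps(2) by blast
    have g: "free_gen (v, w) \<in> carrier (free_module (carrier V \<times> carrier W))"
      using x by (simp add: free_gen_closed)
    show ?case
      using assms(3)[OF tensor_class_closed[OF add.hyps(1)] add.IH x(2,3), of r]
      by (simp add: x(1) pure_tensor_def tensor_class_add tensor_class_smult g add.hyps(1)
          free_module_smult_closed)
  qed
  then show ?thesis by (simp add: f(2))
qed

text \<open>Freezing one argument of a functional on the tensor product leaves a functional on the
  other factor, to which the equation of a single \<open>\<pi>1\<close> or \<open>\<pi>2\<close>
  applies. The restriction to the carrier provides the extensionality that \<open>dual\<close>
  demands.\<close>

lemma dual_pure_tensor:
  assumes "l \<in> dual (tensor_module V W)"
  shows "w \<in> carrier W \<Longrightarrow> (\<lambda>v\<in>carrier V. l (pure_tensor V W v w)) \<in> dual V"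
    and "v \<in> carrier V \<Longrightarrow> (\<lambda>w\<in>carrier W. l (pure_tensor V W v w)) \<in> dual W"
  using assms V.smult_closed W.smult_closed
  by (auto simp: dual_iff pure_tensor_bilinear pure_tensor_closed)

text \<open>The preimage of the kernel is a submodule containing the relations, hence it contains
  their span. This makes the tensor action well defined on classes.\<close>

lemma free_map_tensor_kernel:
  assumes A: "A \<in> LinearCombinations.module_hom class_ring V V"
    and B: "B \<in> LinearCombinations.module_hom class_ring W W"
    and f: "f \<in> tensor_kernel V W"
  shows "free_map (map_prod A B) f \<in> tensor_kernel V W"
proof -
  let ?F = "free_module (carrier V \<times> carrier W) :: ('r, 'a \<times> 'b \<Rightarrow> 'r) module"
  let ?h = "free_map (map_prod A B) :: ('a \<times> 'b \<Rightarrow> 'r) \<Rightarrow> _"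
  define N where "N = {f \<in> carrier ?F. ?h f \<in> tensor_kernel V W}"
  interpret K: LinearCombinations.submodule class_ring "tensor_kernel V W" ?F
    by (rule submodule_tensor_kernel)
  note add = K.m_closed[simplified] and smult = K.smult_closed[simplified] and zero = K.zero_closed[simplified]
  have closed: "A v \<in> carrier V" if "v \<in> carrier V" for v
    using LinearCombinations.module_hom_closed[OF A] that by auto
  have closed': "B w \<in> carrier W" if "w \<in> carrier W" for w
    using LinearCombinations.module_hom_closed[OF B] that by auto
  have "LinearCombinations.submodule class_ring N ?F"
  proof (rule LinearCombinations.submodule.intro)
    show "Module.module class_ring ?F" by (rule module_free)
    show "N \<subseteq> carrier ?F" by (auto simp: N_def)
    show "\<zero>\<^bsub>?F\<^esub> \<in> N"
      using zero by (simp add: N_def free_map_0) (simp add: free_module_def)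
    show "f \<oplus>\<^bsub>?F\<^esub> g \<in> N" if "f \<in> N" "g \<in> N" for f g
      using that add by (simp add: N_def free_module_add_closed free_map_add[of f "carrier V \<times> carrier W" g])
    show "c \<odot>\<^bsub>?F\<^esub> f \<in> N" if "f \<in> N" for c f
      using that smult by (simp add: N_def free_module_smult_closed free_map_smult[of f "carrier V \<times> carrier W"])
  qed
  moreover have "bilinear_relations V W \<subseteq> N"
  proof
    fix r assume r: "r \<in> bilinear_relations V W"
    \<comment> \<open>A linear map in each factor carries a relation to a relation of the same
      family.\<close>
    have "?h r \<in> bilinear_relations V W"
      using r
    proof (cases rule: bilinear_relations_cases)
      case (1 v v' w)
      have "?h r = (\<lambda>z. free_gen (A v \<oplus>\<^bsub>V\<^esub> A v', B w) z - free_gen (A v, B w) z - free_gen (A v', B w) z)"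
        using 1 by (simp add: free_map_diff[of _ "carrier V \<times> carrier W"] free_module_diff_closed
            free_gen_closed free_map_gen LinearCombinations.module_hom_add[OF A])
      then show ?thesis using 1 by (simp add: bilinear_relationsI closed closed')
    next
      case (2 v w w')
      have "?h r = (\<lambda>z. free_gen (A v, B w \<oplus>\<^bsub>W\<^esub> B w') z - free_gen (A v, B w) z - free_gen (A v, B w') z)"
        using 2 by (simp add: free_map_diff[of _ "carrier V \<times> carrier W"] free_module_diff_closed
            free_gen_closed free_map_gen LinearCombinations.module_hom_add[OF B])
      then show ?thesis using 2 by (simp add: bilinear_relationsI closed closed')
    next
      case (3 c v w)
      have "?h r = (\<lambda>z. free_gen (c \<odot>\<^bsub>V\<^esub> A v, B w) z - c * free_gen (A v, B w) z)"
        using 3 by (simp add: free_map_diff[of _ "carrier V \<times> carrier W"] free_module_smult_closed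
            free_map_smult[of _ "carrier V \<times> carrier W"] free_gen_closed free_map_gen LinearCombinations.module_hom_smult[OF A]
            V.smult_closed[simplified])
      then show ?thesis using 3 by (simp add: bilinear_relationsI closed closed')
    next
      case (4 c v w)
      have "?h r = (\<lambda>z. free_gen (A v, c \<odot>\<^bsub>W\<^esub> B w) z - c * free_gen (A v, B w) z)"
        using 4 by (simp add: free_map_diff[of _ "carrier V \<times> carrier W"] free_module_smult_closed
            free_map_smult[of _ "carrier V \<times> carrier W"] free_gen_closed free_map_gen LinearCombinations.module_hom_smult[OF B]
            W.smult_closed[simplified])
      then show ?thesis using 4 by (simp add: bilinear_relationsI closed closed')
    qed
    then show "r \<in> N"
      using r bilinear_relations_subset relation_in_tensor_kernel by (auto simp: N_def)
  qed
  ultimately have "tensor_kernel V W \<subseteq> N"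
    unfolding tensor_kernel_def by (intro module.span_is_subset[OF module_free])
  then show ?thesis using f by (auto simp: N_def)
qed

context
  fixes \<rho> :: "'g \<Rightarrow> 'a \<Rightarrow> 'a" and \<sigma> :: "'h \<Rightarrow> 'b \<Rightarrow> 'b" and g h
  assumes A: "\<rho> g \<in> LinearCombinations.module_hom class_ring V V"
    and B: "\<sigma> h \<in> LinearCombinations.module_hom class_ring W W"
begin

lemma tensor_action_class:
  assumes f: "f \<in> carrier (free_module (carrier V \<times> carrier W))"
  shows "tensor_action V \<rho> W \<sigma> (g, h) (tensor_class V W f) =
    tensor_class V W (free_map (map_prod (\<rho> g) (\<sigma> h)) f)"
proof -
  note ab = submodule_abelian_subgroup[OF submodule_tensor_kernel]
  have "map_prod (\<rho> g) (\<sigma> h) \<in> carrier V \<times> carrier W \<rightarrow> carrier V \<times> carrier W"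
    using LinearCombinations.module_hom_closed[OF A] LinearCombinations.module_hom_closed[OF B] by auto
  then show ?thesis
    using tensor_class_closed[OF f] unfolding tensor_action_def tensor_class_def
    by (simp, intro coset_map_coset[OF ab ab _ _ _ f])
      (auto simp: free_map_add free_map_closed free_map_tensor_kernel[OF A B])
qed

lemma tensor_action_pure:
  "v \<in> carrier V \<Longrightarrow> w \<in> carrier W \<Longrightarrow>
    tensor_action V \<rho> W \<sigma> (g, h) (pure_tensor V W v w) = pure_tensor V W (\<rho> g v) (\<sigma> h w)"
  by (simp add: pure_tensor_def tensor_action_class free_gen_closed free_map_gen)

lemma tensor_action_hom:
  "tensor_action V \<rho> W \<sigma> (g, h) \<in> LinearCombinations.module_hom class_ring (tensor_module V W) (tensor_module V W)"
proof -
  have h: "map_prod (\<rho> g) (\<sigma> h) \<in> carrier V \<times> carrier W \<rightarrow> carrier V \<times> carrier W"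
    using LinearCombinations.module_hom_closed[OF A] LinearCombinations.module_hom_closed[OF B] by auto
  have "tensor_action V \<rho> W \<sigma> (g, h) X \<in> carrier (tensor_module V W)"
    if "X \<in> carrier (tensor_module V W)" for X
  proof -
    obtain f where "f \<in> carrier (free_module (carrier V \<times> carrier W))" "X = tensor_class V W f"
      using \<open>X \<in> carrier (tensor_module V W)\<close> carrier_tensor_module by blast
    then show ?thesis
      by (simp add: tensor_action_class tensor_class_closed free_map_closed[OF _ h])
  qed
  moreover have "tensor_action V \<rho> W \<sigma> (g, h) (X \<oplus>\<^bsub>tensor_module V W\<^esub> Y) =
      tensor_action V \<rho> W \<sigma> (g, h) X \<oplus>\<^bsub>tensor_module V W\<^esub> tensor_action V \<rho> W \<sigma> (g, h) Y"
    if "X \<in> carrier (tensor_module V W)" "Y \<in> carrier (tensor_module V W)" for X Y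
    using that by (auto simp: carrier_tensor_module tensor_action_class tensor_class_add
        free_module_add_closed free_map_add free_map_closed[OF _ h])
  moreover have "tensor_action V \<rho> W \<sigma> (g, h) (r \<odot>\<^bsub>tensor_module V W\<^esub> X) =
      r \<odot>\<^bsub>tensor_module V W\<^esub> tensor_action V \<rho> W \<sigma> (g, h) X"
    if "X \<in> carrier (tensor_module V W)" for r X
    using that by (auto simp: carrier_tensor_module tensor_action_class tensor_class_smult
        free_module_smult_closed free_map_smult free_map_closed[OF _ h])
  ultimately show ?thesis
    by (auto simp: LinearCombinations.module_hom_def)
qed

end

end

section \<open>Induced representations\<close>

text \<open>Pick one element in every right coset of \<open>P\<close>. Unique factorisation turns a
  sum over the group into a double sum without dividing by the order of \<open>P\<close>.\<close>

lemma (in group) right_transversal: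
  assumes P: "subgroup P G"
  obtains K where "K \<subseteq> carrier G" "bij_betw (\<lambda>(p, k). p \<otimes> k) (P \<times> K) (carrier G)"
proof -
  define rep where "rep C = (SOME k. k \<in> C)" for C :: "'a set"
  define K where "K = rep ` (rcosets P)"
  have rep: "rep C \<in> C" "rep C \<in> carrier G" "P #> rep C = C" if C: "C \<in> rcosets P" for C
  proof -
    obtain g where g: "g \<in> carrier G" "C = P #> g" using C by (auto simp: RCOSETS_def)
    have "g \<in> C" using rcos_self[OF g(1) P] g(2) by simp
    then show 1: "rep C \<in> C" unfolding rep_def by (rule someI)
    show "rep C \<in> carrier G"
      using 1 g r_coset_subset_G[OF subgroup.subset[OF P] g(1)] by auto
    show "P #> rep C = C" using repr_independence[OF _ g(1) P] 1 g(2) by metis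
  qed
  have K: "k \<in> carrier G" "rep (P #> k) = k" if "k \<in> K" for k
    using that rep unfolding K_def by auto
  have p: "p \<in> carrier G" if "p \<in> P" for p using that subgroup.subset[OF P] by auto
  have "inj_on (\<lambda>(p, k). p \<otimes> k) (P \<times> K)"
  proof (rule inj_onI, clarify)
    fix p k p' k' assume h: "p \<in> P" "p' \<in> P" "k \<in> K" "k' \<in> K" "p \<otimes> k = p' \<otimes> k'"
    \<comment> \<open>The product determines its coset and therefore the representative;
      cancellation then recovers the factor in \<open>P\<close>.\<close>
    have c: "P #> (p \<otimes> k) = P #> k" if "p \<in> P" "k \<in> K" for p k
      using coset_mult_assoc[OF subgroup.subset[OF P] p[OF that(1)] K(1)[OF that(2)]]
        coset_join2[OF p[OF that(1)] P that(1)] by simp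
    have "k = k'" using c[OF h(1,3)] c[OF h(2,4)] h(5) K(2) h(3,4) by metis
    then show "p = p' \<and> k = k'" using h p K(1) by (metis right_cancel)
  qed
  moreover have "(\<lambda>(p, k). p \<otimes> k) ` (P \<times> K) = carrier G"
  proof (intro equalityI subsetI)
    fix g assume g: "g \<in> carrier G"
    have C: "P #> g \<in> rcosets P" using g by (auto simp: RCOSETS_def)
    have "g \<in> P #> rep (P #> g)" using rep(3)[OF C] rcos_self[OF g P] by simp
    then obtain p where "p \<in> P" "g = p \<otimes> rep (P #> g)"
      unfolding r_coset_def[of G P "rep (P #> g)"] by blast
    then show "g \<in> (\<lambda>(p, k). p \<otimes> k) ` (P \<times> K)"
      using C by (intro image_eqI[of _ _ "(p, rep (P #> g))"]) (auto simp: K_def)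
  qed (use p K in auto)
  moreover have "K \<subseteq> carrier G" using K by auto
  ultimately show ?thesis using that by (simp add: bij_betw_def)
qed

lemma induced_module_simps [simp]:
  "\<zero>\<^bsub>induced_module G P V \<sigma>\<^esub> = (\<lambda>g\<in>carrier G. \<zero>\<^bsub>V\<^esub>)"
  "f \<oplus>\<^bsub>induced_module G P V \<sigma>\<^esub> f' = (\<lambda>g\<in>carrier G. f g \<oplus>\<^bsub>V\<^esub> f' g)"
  "r \<odot>\<^bsub>induced_module G P V \<sigma>\<^esub> f = (\<lambda>g\<in>carrier G. r \<odot>\<^bsub>V\<^esub> f g)"
  by (simp_all add: induced_module_def)

lemma carrier_induced_module:
  "f \<in> carrier (induced_module G P V \<sigma>) \<longleftrightarrow> f \<in> carrier G \<rightarrow>\<^sub>E carrier V \<and>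
    (\<forall>p\<in>P. \<forall>g\<in>carrier G. f (p \<otimes>\<^bsub>G\<^esub> g) = \<sigma> p (f g))"
  by (simp add: induced_module_def)

text \<open>The inflated action is meaningful only on \<open>P\<close>, so linearity and
  multiplicativity are asked for there. This keeps the analysis of induced functionals free of
  matrices and tensors.\<close>

locale induction_datum = group G + P: subgroup P G + T: Module.module "class_ring :: 'r::comm_ring_1 ring" T
  for G (structure) and P and T :: "('r::comm_ring_1, 'c) module" +
  fixes \<sigma> :: "'a \<Rightarrow> 'c \<Rightarrow> 'c"
  assumes sigma_hom: "p \<in> P \<Longrightarrow> \<sigma> p \<in> LinearCombinations.module_hom class_ring T T"
    and sigma_mult: "p \<in> P \<Longrightarrow> p' \<in> P \<Longrightarrow> t \<in> carrier T \<Longrightarrow> \<sigma> (p \<otimes> p') t = \<sigma> p (\<sigma> p' t)"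
begin

lemma sigma_closed: "p \<in> P \<Longrightarrow> t \<in> carrier T \<Longrightarrow> \<sigma> p t \<in> carrier T"
  using LinearCombinations.module_hom_closed[OF sigma_hom] by auto

lemma sigma_add:
  "p \<in> P \<Longrightarrow> t \<in> carrier T \<Longrightarrow> t' \<in> carrier T \<Longrightarrow> \<sigma> p (t \<oplus>\<^bsub>T\<^esub> t') = \<sigma> p t \<oplus>\<^bsub>T\<^esub> \<sigma> p t'"
  using LinearCombinations.module_hom_add[OF sigma_hom] by auto

lemma sigma_smult: "p \<in> P \<Longrightarrow> t \<in> carrier T \<Longrightarrow> \<sigma> p (r \<odot>\<^bsub>T\<^esub> t) = r \<odot>\<^bsub>T\<^esub> \<sigma> p t"
  using LinearCombinations.module_hom_smult[OF sigma_hom] by auto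

lemma sigma_zero: "p \<in> P \<Longrightarrow> \<sigma> p \<zero>\<^bsub>T\<^esub> = \<zero>\<^bsub>T\<^esub>"
  by (rule module_hom_zero[OF T.module_axioms T.module_axioms sigma_hom])

text \<open>An equivariant function is the sum of its restrictions to the cosets \<open>P k\<close>,
  and each restriction is determined linearly by the value at \<open>k\<close>. Hence a functional
  splits into one functional of each such value.\<close>

lemma dual_induced_module:
  assumes l: "l \<in> dual (induced_module G P T \<sigma>)"
    and K: "K \<subseteq> carrier G" "finite K" "bij_betw (\<lambda>(p, k). p \<otimes> k) (P \<times> K) (carrier G)"
  obtains \<mu> where "\<And>k. k \<in> K \<Longrightarrow> \<mu> k \<in> dual T"
    "\<And>f. f \<in> carrier (induced_module G P T \<sigma>) \<Longrightarrow> l f = (\<Sum>k\<in>K. \<mu> k (f k))"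
proof -
  let ?V = "induced_module G P T \<sigma>"
  define \<pi> where "\<pi> = inv_into (P \<times> K) (\<lambda>(p, k). p \<otimes> k)"
  define pt where "pt g = fst (\<pi> g)" for g
  define rt where "rt g = snd (\<pi> g)" for g
  have inj: "inj_on (\<lambda>(p, k). p \<otimes> k) (P \<times> K)" and img: "(\<lambda>(p, k). p \<otimes> k) ` (P \<times> K) = carrier G"
    using K(3) by (auto simp: bij_betw_def)
  have dec: "pt g \<in> P" "rt g \<in> K" "pt g \<otimes> rt g = g" if "g \<in> carrier G" for g
  proof -
    have "\<pi> g \<in> P \<times> K" unfolding \<pi>_def using that img by (intro inv_into_into) simp
    then show "pt g \<in> P" "rt g \<in> K" by (auto simp: pt_def rt_def mem_Times_iff)
    show "pt g \<otimes> rt g = g"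
      using f_inv_into_f[of g "\<lambda>(p, k). p \<otimes> k" "P \<times> K"] that img by (simp add: \<pi>_def pt_def rt_def split_def)
  qed
  have uniq: "pt (p \<otimes> k) = p" "rt (p \<otimes> k) = k" if "p \<in> P" "k \<in> K" for p k
    using inv_into_f_f[OF inj, of "(p, k)"] that by (simp_all add: pt_def rt_def \<pi>_def)
  \<comment> \<open>Left multiplication by \<open>P\<close> changes only the
    \<open>P\<close>-coordinate; this is what makes \<open>\<delta>\<close> and \<open>cut\<close>
    equivariant.\<close>
  have left: "pt (p \<otimes> g) = p \<otimes> pt g" "rt (p \<otimes> g) = rt g" if "p \<in> P" "g \<in> carrier G" for p g
  proof -
    have "p \<otimes> g = (p \<otimes> pt g) \<otimes> rt g"
      using dec[OF that(2)] that K(1) by (metis P.mem_carrier m_assoc subsetD)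
    then show "pt (p \<otimes> g) = p \<otimes> pt g" "rt (p \<otimes> g) = rt g"
      using uniq[of "p \<otimes> pt g" "rt g"] dec[OF that(2)] that(1) by auto
  qed
  \<comment> \<open>The function supported on the coset \<open>P k\<close> that takes the value
    \<open>\<sigma> p t\<close> at \<open>p \<otimes> k\<close>.\<close>
  define \<delta> where "\<delta> k t = (\<lambda>g\<in>carrier G. if rt g = k then \<sigma> (pt g) t else \<zero>\<^bsub>T\<^esub>)" for k t
  \<comment> \<open>Truncation to the cosets with representative in \<open>S\<close>; enlarging
    \<open>S\<close> one element at a time replaces a finite sum in the module by an
    induction.\<close>
  define cut where "cut S f = (\<lambda>g\<in>carrier G. if rt g \<in> S then f g else \<zero>\<^bsub>T\<^esub>)" for S f
  have \<delta>: "\<delta> k t \<in> carrier ?V" if "t \<in> carrier T" for k t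
    using that by (auto simp: carrier_induced_module \<delta>_def left dec sigma_closed sigma_mult sigma_zero)
  have cut: "cut S f \<in> carrier ?V" if "f \<in> carrier ?V" for S f
    using that by (auto simp: carrier_induced_module cut_def left sigma_zero)
  have \<delta>_add: "\<delta> k (t \<oplus>\<^bsub>T\<^esub> t') = \<delta> k t \<oplus>\<^bsub>?V\<^esub> \<delta> k t'" if "t \<in> carrier T" "t' \<in> carrier T" for k t t'
    using that by (auto simp: \<delta>_def dec sigma_add)
  have \<delta>_smult: "\<delta> k (r \<odot>\<^bsub>T\<^esub> t) = r \<odot>\<^bsub>?V\<^esub> \<delta> k t" if "t \<in> carrier T" for k r t
    using that by (auto simp: \<delta>_def dec sigma_smult)
  define \<mu> where "\<mu> k = (\<lambda>t\<in>carrier T. l (\<delta> k t))" for k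
  have l_add: "l (f \<oplus>\<^bsub>?V\<^esub> f') = l f + l f'" if "f \<in> carrier ?V" "f' \<in> carrier ?V" for f f'
    using l that unfolding dual_iff by blast
  have l_smult: "l (r \<odot>\<^bsub>?V\<^esub> f) = r * l f" if "f \<in> carrier ?V" for r f
    using l that unfolding dual_iff by blast
  have "\<mu> k \<in> dual T" for k
    using T.smult_closed[simplified]
    by (auto simp: dual_iff \<mu>_def \<delta>_add \<delta>_smult l_add l_smult \<delta> simp del: induced_module_simps)
  moreover have "l f = (\<Sum>k\<in>K. \<mu> k (f k))" if f: "f \<in> carrier ?V" for f
  proof -
    have fT: "f g \<in> carrier T" if "g \<in> carrier G" for g
      using f that by (auto simp: carrier_induced_module)
    have "l (cut S f) = (\<Sum>k\<in>S. \<mu> k (f k))" if "finite S" "S \<subseteq> K" for S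
      using that
    proof (induction S rule: finite_induct)
      case empty
      \<comment> \<open>The zero function is its own multiple by 0, so homogeneity of
        \<open>l\<close> alone forces the value 0.\<close>
      have "cut {} f = 0 \<odot>\<^bsub>?V\<^esub> cut {} f"
        by (auto simp: cut_def)
      then have "l (cut {} f) = 0 * l (cut {} f)"
        using l_smult[OF cut[OF f]] by metis
      then show ?case by simp
    next
      case (insert k S)
      then have k: "k \<in> carrier G" using K(1) by auto
      \<comment> \<open>Equivariance recovers \<open>f\<close> on a whole coset from its value at
        the representative, so the part of \<open>f\<close> on the coset of \<open>k\<close> is
        \<open>\<delta> k (f k)\<close>.\<close>
      have "f g = \<sigma> (pt g) (f (rt g))" if "g \<in> carrier G" for g
        using f dec[OF that] K(1) by (metis carrier_induced_module subsetD)
      then have "cut (insert k S) f = \<delta> k (f k) \<oplus>\<^bsub>?V\<^esub> cut S f"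
        using insert.hyps(2) fT by (auto simp: cut_def \<delta>_def fun_eq_iff)
      then show ?case
        using insert by (simp add: l_add[OF \<delta>[OF fT[OF k]] cut[OF f]] \<mu>_def fT[OF k] del: induced_module_simps)
    qed
    from this[OF K(2) order_refl] have "l (cut K f) = (\<Sum>k\<in>K. \<mu> k (f k))" .
    moreover have "cut K f = f"
      using f by (auto simp: cut_def carrier_induced_module dec PiE_def extensional_def fun_eq_iff)
    ultimately show ?thesis by simp
  qed
  ultimately show ?thesis by (rule that)
qed

lemma induced_action_closed:
  assumes "x \<in> carrier G" "f \<in> carrier (induced_module G P T \<sigma>)"
  shows "induced_action G P T \<sigma> x f \<in> carrier (induced_module G P T \<sigma>)"
  using assms by (auto simp: induced_action_def carrier_induced_module m_assoc P.mem_carrier)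

text \<open>Additivity is what lets the action descend to cosets in the subquotient.\<close>

lemma induced_action_add:
  assumes "x \<in> carrier G" "f \<in> carrier (induced_module G P T \<sigma>)" "f' \<in> carrier (induced_module G P T \<sigma>)"
  shows "induced_action G P T \<sigma> x (f \<oplus>\<^bsub>induced_module G P T \<sigma>\<^esub> f') =
    induced_action G P T \<sigma> x f \<oplus>\<^bsub>induced_module G P T \<sigma>\<^esub> induced_action G P T \<sigma> x f'"
proof -
  have "(f \<oplus>\<^bsub>induced_module G P T \<sigma>\<^esub> f') \<in> carrier (induced_module G P T \<sigma>)"
    using assms(2,3) by (auto simp: carrier_induced_module sigma_add P.mem_carrier Pi_iff PiE_def)
  then show ?thesis
    using assms by (auto simp: induced_action_def)
qed

end

section \<open>Gamma factors\<close>

lemma gamma_factorD: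
  assumes "gamma_factor \<T> s \<psi> m V \<rho> \<gamma>" "v \<in> carrier V" "l \<in> dual V" "\<Phi> \<in> \<T>"
  shows "(\<Sum>g\<in>carrier (GL m). fourier s \<psi> m \<Phi> g * l (\<rho> (inv\<^bsub>GL m\<^esub> g) v)) =
    \<gamma> * (\<Sum>g\<in>carrier (GL m). \<Phi> g * l (\<rho> g v))"
  using assms unfolding gamma_factor_def by blast

text \<open>
  With \<open>l f = (\<Sum>x\<in>K. \<mu> x (f x))\<close> for a transversal \<open>K\<close> of \<open>P\<close> and \<open>g = x\<inverse> p k\<close>, both sides of the
  functional equation become sums over \<open>x, k \<in> K\<close> of functional equations on \<open>P\<close> for the translates
  \<open>\<Phi> (x\<inverse> \<cdot> k)\<close>.
\<close>

lemma gamma_factor_induced: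
  fixes T :: "('r::comm_ring_1, 'c) module" and \<psi> :: "'k::finite_field \<Rightarrow> 'r"
  assumes P: "induction_datum (GL m) P T \<sigma>"
    and translate: "\<And>\<Phi> x k. \<Phi> \<in> \<T> \<Longrightarrow> x \<in> carrier (GL m) \<Longrightarrow> k \<in> carrier (GL m) \<Longrightarrow>
      (\<lambda>g. \<Phi> (inv\<^bsub>GL m\<^esub> x * g * k)) \<in> \<T>"
    and gamma: "\<And>\<Phi> l t. \<Phi> \<in> \<T> \<Longrightarrow> l \<in> dual T \<Longrightarrow> t \<in> carrier T \<Longrightarrow>
      (\<Sum>p\<in>P. fourier s \<psi> m \<Phi> (inv\<^bsub>GL m\<^esub> p) * l (\<sigma> p t)) = \<gamma> * (\<Sum>p\<in>P. \<Phi> p * l (\<sigma> p t))"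
  shows "gamma_factor \<T> s \<psi> m (induced_module (GL m) P T \<sigma>) (induced_action (GL m) P T \<sigma>) \<gamma>"
  unfolding gamma_factor_def
proof (intro ballI)
  interpret induction_datum "GL m :: 'k mat monoid" P T \<sigma> by (rule P)
  let ?G = "carrier (GL m) :: 'k mat set"
  let ?V = "induced_module (GL m) P T \<sigma>" and ?\<rho> = "induced_action (GL m) P T \<sigma>"
  let ?i = "m_inv (GL m :: 'k mat monoid)"
  fix f l \<Phi>
  assume f: "f \<in> carrier ?V" and l: "l \<in> dual ?V" and \<Phi>: "\<Phi> \<in> \<T>"
  obtain K where K: "K \<subseteq> ?G" and bij: "bij_betw (\<lambda>(p, k). p \<otimes>\<^bsub>GL m\<^esub> k) (P \<times> K) ?G"
    using right_transversal[OF P.subgroup_axioms] by blast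
  have "finite K" using K finite_GL finite_subset by blast
  from dual_induced_module[OF l K this bij] obtain \<mu> where \<mu>: "\<And>k. k \<in> K \<Longrightarrow> \<mu> k \<in> dual T"
    "\<And>f. f \<in> carrier ?V \<Longrightarrow> l f = (\<Sum>k\<in>K. \<mu> k (f k))" by blast
  have mult_closed: "x * y \<in> ?G" if "x \<in> ?G" "y \<in> ?G" for x y
    using m_closed[OF that] by simp
  have inv_closed: "?i x \<in> ?G" if "x \<in> ?G" for x
    using that by (rule inv_closed)
  have assoc: "x * y * z = x * (y * z)" if "x \<in> ?G" "y \<in> ?G" "z \<in> ?G" for x y z
    using m_assoc[OF that] by simp
  have K': "k \<in> ?G" if "k \<in> K" for k using that K by auto
  have fT: "f k \<in> carrier T" if "k \<in> ?G" for k
    using f that by (auto simp: carrier_induced_module)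
  have act: "l (?\<rho> g f) = (\<Sum>x\<in>K. \<mu> x (f (x * g)))" if "g \<in> ?G" for g
    using \<mu>(2)[OF induced_action_closed[OF that f]] f K'
    by (simp add: induced_action_def mult_closed cong: sum.cong)
  have sum_G: "(\<Sum>g\<in>?G. u g) = (\<Sum>k\<in>K. \<Sum>p\<in>P. u (p * k))" for u :: "'k mat \<Rightarrow> 'r"
  proof -
    have "(\<Sum>g\<in>?G. u g) = (\<Sum>(p, k)\<in>P \<times> K. u (p * k))"
      using sum.reindex_bij_betw[OF bij, of u] by (simp add: split_def)
    also have "\<dots> = (\<Sum>p\<in>P. \<Sum>k\<in>K. u (p * k))"
      by (rule sum.cartesian_product[symmetric])
    also have "\<dots> = (\<Sum>k\<in>K. \<Sum>p\<in>P. u (p * k))"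
      by (rule sum.swap)
    finally show ?thesis .
  qed
  have fp: "f (p * k) = \<sigma> p (f k)" if "p \<in> P" "k \<in> ?G" for p k
    using f that by (auto simp: carrier_induced_module)
  define \<Phi>' where "\<Phi>' x k = (\<lambda>g. \<Phi> (?i x * g * k))" for x k
  have "(\<Sum>g\<in>?G. \<Phi> g * l (?\<rho> g f)) = (\<Sum>x\<in>K. \<Sum>g\<in>?G. \<Phi> g * \<mu> x (f (x * g)))"
    by (subst sum.swap) (simp add: act sum_distrib_left)
  \<comment> \<open>Substitute \<open>h = x * g\<close>, so that \<open>f\<close> is evaluated at
    the summation variable before it is split along cosets.\<close>
  also have "\<dots> = (\<Sum>x\<in>K. \<Sum>h\<in>?G. \<Phi> (?i x * h) * \<mu> x (f h))"
  proof (rule sum.cong[OF refl])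
    fix x assume "x \<in> K"
    then have x: "x \<in> ?G" by (rule K')
    show "(\<Sum>g\<in>?G. \<Phi> g * \<mu> x (f (x * g))) = (\<Sum>h\<in>?G. \<Phi> (?i x * h) * \<mu> x (f h))"
      by (rule sum.reindex_bij_witness[where i = "\<lambda>h. ?i x * h" and j = "\<lambda>g. x * g"])
        (simp_all add: x mult_closed inv_closed GL_inv_mult[OF x, of _ m])
  qed
  also have "\<dots> = (\<Sum>x\<in>K. \<Sum>k\<in>K. \<Sum>p\<in>P. \<Phi>' x k p * \<mu> x (\<sigma> p (f k)))"
    by (subst sum_G, intro sum.cong refl)
      (simp add: \<Phi>'_def fp K' P.mem_carrier assoc inv_closed)
  finally have R: "(\<Sum>g\<in>?G. \<Phi> g * l (?\<rho> g f)) =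
    (\<Sum>x\<in>K. \<Sum>k\<in>K. \<Sum>p\<in>P. \<Phi>' x k p * \<mu> x (\<sigma> p (f k)))" .
  have "(\<Sum>g\<in>?G. fourier s \<psi> m \<Phi> g * l (?\<rho> (?i g) f)) =
      (\<Sum>x\<in>K. \<Sum>g\<in>?G. fourier s \<psi> m \<Phi> g * \<mu> x (f (x * ?i g)))"
    by (subst sum.swap) (simp add: act inv_closed sum_distrib_left)
  \<comment> \<open>Here the action carries an inverse, so the substitution is
    \<open>h = x * g\<inverse>\<close>, that is \<open>g = h\<inverse> * x\<close>.\<close>
  also have "\<dots> = (\<Sum>x\<in>K. \<Sum>h\<in>?G. fourier s \<psi> m \<Phi> (?i h * x) * \<mu> x (f h))"
  proof (rule sum.cong[OF refl])
    fix x assume "x \<in> K"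
    then have x: "x \<in> ?G" by (rule K')
    have i1: "?i (?i h * x) = ?i x * h" if "h \<in> ?G" for h
      using inv_mult_group[of "?i h" x] that x by (simp add: inv_closed)
    have i2: "?i (x * ?i g) = g * ?i x" if "g \<in> ?G" for g
      using inv_mult_group[of x "?i g"] that x by (simp add: inv_closed)
    show "(\<Sum>g\<in>?G. fourier s \<psi> m \<Phi> g * \<mu> x (f (x * ?i g))) =
        (\<Sum>h\<in>?G. fourier s \<psi> m \<Phi> (?i h * x) * \<mu> x (f h))"
      by (rule sum.reindex_bij_witness[where i = "\<lambda>h. ?i h * x" and j = "\<lambda>g. x * ?i g"])
        (simp_all add: x i1 i2 mult_closed inv_closed GL_inv_mult[OF x, of _ m] GL_mult_inv[OF x, of _ m])
  qed
  also have "\<dots> = (\<Sum>x\<in>K. \<Sum>k\<in>K. \<Sum>p\<in>P. fourier s \<psi> m (\<Phi>' x k) (?i p) * \<mu> x (\<sigma> p (f k)))"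
  proof (subst sum_G, intro sum.cong refl)
    fix x k p assume "x \<in> K" "k \<in> K" "p \<in> P"
    then have h: "x \<in> ?G" "k \<in> ?G" "p \<in> ?G" "p \<in> P" by (auto simp: K' P.mem_carrier)
    \<comment> \<open>The argument becomes \<open>p\<inverse>\<close> translated by
      \<open>k\<inverse>\<close> on the left and \<open>x\<close> on the right: the Fourier
      transform there is that of \<open>\<Phi>' x k\<close> at \<open>p\<inverse>\<close>, the same
      translate as on the other side.\<close>
    have "?i (p * k) * x = ?i k * ?i p * x"
      using inv_mult_group[of p k] h by simp
    then show "fourier s \<psi> m \<Phi> (?i (p * k) * x) * \<mu> x (f (p * k)) =
        fourier s \<psi> m (\<Phi>' x k) (?i p) * \<mu> x (\<sigma> p (f k))"
      using fourier_translate[OF h(1,2) GL_carrier_mat[OF inv_closed[OF h(3)]], of s \<psi> \<Phi>]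
      by (simp add: \<Phi>'_def fp h)
  qed
  also have "\<dots> = (\<Sum>x\<in>K. \<Sum>k\<in>K. \<gamma> * (\<Sum>p\<in>P. \<Phi>' x k p * \<mu> x (\<sigma> p (f k))))"
    by (intro sum.cong refl gamma \<mu>(1) fT K') (auto simp: \<Phi>'_def intro!: translate[OF \<Phi>] K')
  also have "\<dots> = \<gamma> * (\<Sum>g\<in>?G. \<Phi> g * l (?\<rho> g f))"
    by (simp add: R sum_distrib_left)
  finally show "(\<Sum>g\<in>?G. fourier s \<psi> m \<Phi> g * l (?\<rho> (?i g) f)) = \<gamma> * (\<Sum>g\<in>?G. \<Phi> g * l (?\<rho> g f))" .
qed

text \<open>The functional equation sees a representation only through its matrix coefficients, and
  every coefficient of the subquotient is also a coefficient of \<open>V\<close>.\<close>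

lemma gamma_factor_subquotient:
  fixes V :: "('r::comm_ring_1, 'v) module" and \<psi> :: "'k::finite_field \<Rightarrow> 'r"
  assumes W1: "LinearCombinations.submodule class_ring W1 V" "stable (GL m) \<rho> W1"
    and W2: "LinearCombinations.submodule class_ring W2 V" "stable (GL m) \<rho> W2" and "W2 \<subseteq> W1"
    and add: "\<And>g v w. g \<in> carrier (GL m) \<Longrightarrow> v \<in> carrier V \<Longrightarrow> w \<in> carrier V \<Longrightarrow>
      \<rho> g (v \<oplus>\<^bsub>V\<^esub> w) = \<rho> g v \<oplus>\<^bsub>V\<^esub> \<rho> g w"
    and restr: "dual (V\<lparr>carrier := W1\<rparr>) \<subseteq> (\<lambda>l. restrict l W1) ` dual V"
    and gamma: "gamma_factor \<T> s \<psi> m V \<rho> \<gamma>"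
  shows "gamma_factor \<T> s \<psi> m (subquotient_module V W1 W2) (subquotient_action V \<rho> W1 W2) \<gamma>"
  unfolding gamma_factor_def
proof (intro ballI)
  let ?V1 = "V\<lparr>carrier := W1\<rparr>"
  let ?U = "subquotient_module V W1 W2" and ?\<pi> = "subquotient_action V \<rho> W1 W2"
  interpret V: Module.module class_ring V by (rule submodule.module[OF W1(1)])
  have V1: "Module.module class_ring ?V1" by (rule V.submodule_is_module[OF W1(1)])
  interpret W2: LinearCombinations.submodule class_ring W2 V by (rule W2(1))
  have sub: "LinearCombinations.submodule class_ring W2 ?V1"
    using V1 \<open>W2 \<subseteq> W1\<close> W2.m_closed W2.zero_closed W2.smult_closed
    by (intro LinearCombinations.submodule.intro) auto
  note ab = submodule_abelian_subgroup[OF sub]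
  have W1V: "w \<in> carrier V" if "w \<in> W1" for w
    using submodule.subset[OF W1(1)] that by auto
  fix X l \<Phi>
  assume X: "X \<in> carrier ?U" and l: "l \<in> dual ?U" and \<Phi>: "\<Phi> \<in> \<T>"
  obtain w where w: "w \<in> W1" "X = W2 +>\<^bsub>?V1\<^esub> w"
    using X by (auto simp: subquotient_module_def carrier_quotient_module)
  define l' where "l' = (\<lambda>w\<in>W1. l (W2 +>\<^bsub>?V1\<^esub> w))"
  interpret W1: LinearCombinations.submodule class_ring W1 V by (rule W1(1))
  have l_add: "l (X \<oplus>\<^bsub>?U\<^esub> Y) = l X + l Y" if "X \<in> carrier ?U" "Y \<in> carrier ?U" for X Y
    using l that unfolding dual_iff by blast
  have l_smult: "l (r \<odot>\<^bsub>?U\<^esub> X) = r * l X" if "X \<in> carrier ?U" for r X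
    using l that unfolding dual_iff by blast
  have coset: "W2 +>\<^bsub>?V1\<^esub> x \<in> carrier ?U" if "x \<in> W1" for x
    using coset_in_quotient[OF sub] that by (simp add: subquotient_module_def)
  have "l (W2 +>\<^bsub>?V1\<^esub> (x \<oplus>\<^bsub>V\<^esub> y)) = l (W2 +>\<^bsub>?V1\<^esub> x) + l (W2 +>\<^bsub>?V1\<^esub> y)"
    if "x \<in> W1" "y \<in> W1" for x y
    using l_add[OF coset coset, OF that] quotient_add[OF sub, of x y] that
    by (simp add: subquotient_module_def)
  moreover have "l (W2 +>\<^bsub>?V1\<^esub> (r \<odot>\<^bsub>V\<^esub> x)) = r * l (W2 +>\<^bsub>?V1\<^esub> x)" if "x \<in> W1" for r x
    using l_smult[OF coset[OF that], of r] quotient_smult[OF sub, of x r] that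
    by (simp add: subquotient_module_def)
  ultimately have "l' \<in> dual ?V1"
    using W1.m_closed W1.smult_closed by (simp add: dual_iff l'_def)
  \<comment> \<open>Any extension will do, since the orbit of \<open>w\<close> stays in
    \<open>W1\<close>, where \<open>L\<close> agrees with \<open>l'\<close>.\<close>
  then obtain L where L: "L \<in> dual V" "l' = restrict L W1" using restr by auto
  have act: "l (?\<pi> g X) = L (\<rho> g w)" if g: "g \<in> carrier (GL m)" for g
  proof -
    have st: "\<rho> g v \<in> W1" if "v \<in> W1" for v
      using W1(2) g that by (auto simp: stable_def)
    have "?\<pi> g X = W2 +>\<^bsub>?V1\<^esub> \<rho> g w"
      using X unfolding subquotient_action_def w(2)
      by (simp, intro coset_map_coset[OF ab ab])
        (use W2(2) g w(1) st W1V in \<open>auto simp: stable_def add\<close>)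
    then show ?thesis
      using st[OF w(1)] fun_cong[OF L(2), of "\<rho> g w"] by (simp add: l'_def)
  qed
  interpret G: group "GL m :: 'k mat monoid" by (rule group_GL)
  show "(\<Sum>g\<in>carrier (GL m). fourier s \<psi> m \<Phi> g * l (?\<pi> (inv\<^bsub>GL m\<^esub> g) X)) =
      \<gamma> * (\<Sum>g\<in>carrier (GL m). \<Phi> g * l (?\<pi> g X))"
    using gamma_factorD[OF gamma W1V[OF w(1)] L(1) \<Phi>] by (simp add: act)
qed

text \<open>All functions and those supported on the invertible matrices are both of this form.\<close>

definition vanishing :: "'k mat set \<Rightarrow> ('k mat \<Rightarrow> 'r::zero) set" where
  "vanishing Z = {\<Phi>. \<forall>g\<in>Z. \<Phi> g = 0}"

text \<open>For fixed \<open>d\<close> the partial transform in the second block is itself a test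
  function of \<open>A\<close>, so the equation of \<open>\<pi>1\<close> can be applied before the
  one of \<open>\<pi>2\<close>. Each application extracts one scalar, and the scalars
  multiply.\<close>

lemma gamma_factor_bilinear:
  fixes V1 :: "('r::comm_ring_1, 'a) module" and V2 :: "('r, 'b) module"
    and \<psi> :: "'k::finite_field \<Rightarrow> 'r" and F :: "'k mat \<Rightarrow> 'k mat \<Rightarrow> 'r"
  assumes rep1: "representation (GL n1) V1 \<pi>1" and rep2: "representation (GL n2) V2 \<pi>2"
    and gamma1: "gamma_factor (vanishing Z1) s1 \<psi> n1 V1 \<pi>1 \<gamma>1"
    and gamma2: "gamma_factor (vanishing Z2) s2 \<psi> n2 V2 \<pi>2 \<gamma>2"
    and \<beta>1: "\<And>w. w \<in> carrier V2 \<Longrightarrow> (\<lambda>v\<in>carrier V1. \<beta> v w) \<in> dual V1"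
    and \<beta>2: "\<And>v. v \<in> carrier V1 \<Longrightarrow> (\<lambda>w\<in>carrier V2. \<beta> v w) \<in> dual V2"
    and F1: "\<And>A D. A \<in> Z1 \<Longrightarrow> F A D = 0" and F2: "\<And>A D. D \<in> Z2 \<Longrightarrow> F A D = 0"
    and v: "v \<in> carrier V1" and w: "w \<in> carrier V2"
  shows "(\<Sum>a\<in>carrier (GL n1). \<Sum>d\<in>carrier (GL n2).
      fourier s1 \<psi> n1 (\<lambda>A. fourier s2 \<psi> n2 (F A) d) a *
      \<beta> (\<pi>1 (inv\<^bsub>GL n1\<^esub> a) v) (\<pi>2 (inv\<^bsub>GL n2\<^esub> d) w)) =
    \<gamma>1 * \<gamma>2 * (\<Sum>a\<in>carrier (GL n1). \<Sum>d\<in>carrier (GL n2). F a d * \<beta> (\<pi>1 a v) (\<pi>2 d w))"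
proof -
  let ?G1 = "carrier (GL n1) :: 'k mat set" and ?G2 = "carrier (GL n2) :: 'k mat set"
  have c1: "\<pi>1 a v \<in> carrier V1" if "a \<in> ?G1" for a
    using rep1 that v group_action.element_image unfolding representation_def by fast
  have c2: "\<pi>2 d w \<in> carrier V2" if "d \<in> ?G2" for d
    using rep2 that w group_action.element_image unfolding representation_def by fast
  note i = GL_inv(1)
  have "(\<Sum>a\<in>?G1. \<Sum>d\<in>?G2. fourier s1 \<psi> n1 (\<lambda>A. fourier s2 \<psi> n2 (F A) d) a *
      \<beta> (\<pi>1 (inv\<^bsub>GL n1\<^esub> a) v) (\<pi>2 (inv\<^bsub>GL n2\<^esub> d) w)) =
    (\<Sum>d\<in>?G2. \<Sum>a\<in>?G1. fourier s1 \<psi> n1 (\<lambda>A. fourier s2 \<psi> n2 (F A) d) a *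
      \<beta> (\<pi>1 (inv\<^bsub>GL n1\<^esub> a) v) (\<pi>2 (inv\<^bsub>GL n2\<^esub> d) w))"
    by (rule sum.swap)
  also have "\<dots> = (\<Sum>d\<in>?G2. \<gamma>1 * (\<Sum>a\<in>?G1. fourier s2 \<psi> n2 (F a) d * \<beta> (\<pi>1 a v) (\<pi>2 (inv\<^bsub>GL n2\<^esub> d) w)))"
  proof (intro sum.cong refl)
    fix d assume d: "d \<in> ?G2"
    \<comment> \<open>Transforming in \<open>D\<close> does not mix different \<open>A\<close>, so
      vanishing in the first block survives.\<close>
    have "(\<lambda>A. fourier s2 \<psi> n2 (F A) d) \<in> vanishing Z1"
      by (simp add: vanishing_def fourier_def F1)
    from gamma_factorD[OF gamma1 v \<beta>1[OF c2[OF i[OF d]]] this]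
    show "(\<Sum>a\<in>?G1. fourier s1 \<psi> n1 (\<lambda>A. fourier s2 \<psi> n2 (F A) d) a *
        \<beta> (\<pi>1 (inv\<^bsub>GL n1\<^esub> a) v) (\<pi>2 (inv\<^bsub>GL n2\<^esub> d) w)) =
      \<gamma>1 * (\<Sum>a\<in>?G1. fourier s2 \<psi> n2 (F a) d * \<beta> (\<pi>1 a v) (\<pi>2 (inv\<^bsub>GL n2\<^esub> d) w))"
      by (simp add: c1 i)
  qed
  also have "\<dots> = \<gamma>1 * (\<Sum>a\<in>?G1. \<Sum>d\<in>?G2. fourier s2 \<psi> n2 (F a) d * \<beta> (\<pi>1 a v) (\<pi>2 (inv\<^bsub>GL n2\<^esub> d) w))"
    by (subst sum.swap) (simp add: sum_distrib_left)
  also have "\<dots> = \<gamma>1 * (\<Sum>a\<in>?G1. \<gamma>2 * (\<Sum>d\<in>?G2. F a d * \<beta> (\<pi>1 a v) (\<pi>2 d w)))"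
  proof (intro arg_cong2[where f = "(*)"] sum.cong refl)
    fix a assume a: "a \<in> ?G1"
    have "F a \<in> vanishing Z2" by (simp add: vanishing_def F2)
    from gamma_factorD[OF gamma2 w \<beta>2[OF c1[OF a]] this]
    show "(\<Sum>d\<in>?G2. fourier s2 \<psi> n2 (F a) d * \<beta> (\<pi>1 a v) (\<pi>2 (inv\<^bsub>GL n2\<^esub> d) w)) =
      \<gamma>2 * (\<Sum>d\<in>?G2. F a d * \<beta> (\<pi>1 a v) (\<pi>2 d w))"
      by (simp add: c2 i)
  qed
  finally show ?thesis by (simp add: sum_distrib_left mult_ac)
qed

section \<open>Tensor products inflated to the parabolic subgroup\<close>

lemma representationD:
  assumes "representation G V \<rho>"
  shows "Module.module class_ring V"
    and "g \<in> carrier G \<Longrightarrow> \<rho> g \<in> LinearCombinations.module_hom class_ring V V"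
    and "g \<in> carrier G \<Longrightarrow> v \<in> carrier V \<Longrightarrow> \<rho> g v \<in> carrier V"
    and "g \<in> carrier G \<Longrightarrow> h \<in> carrier G \<Longrightarrow> v \<in> carrier V \<Longrightarrow> \<rho> (g \<otimes>\<^bsub>G\<^esub> h) v = \<rho> g (\<rho> h v)"
proof -
  interpret group_action G "carrier V" \<rho>
    using assms unfolding representation_def by blast
  show "Module.module class_ring V"
    "g \<in> carrier G \<Longrightarrow> \<rho> g \<in> LinearCombinations.module_hom class_ring V V"
    using assms unfolding representation_def by blast+
  show "g \<in> carrier G \<Longrightarrow> v \<in> carrier V \<Longrightarrow> \<rho> g v \<in> carrier V"
    by (rule element_image[OF _ _ refl])
  show "g \<in> carrier G \<Longrightarrow> h \<in> carrier G \<Longrightarrow> v \<in> carrier V \<Longrightarrow> \<rho> (g \<otimes>\<^bsub>G\<^esub> h) v = \<rho> g (\<rho> h v)"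
    by (rule composition_rule)
qed

context
  fixes V1 :: "('r::comm_ring_1, 'a) module" and \<pi>1 :: "'k::finite_field mat \<Rightarrow> 'a \<Rightarrow> 'a"
    and V2 :: "('r, 'b) module" and \<pi>2 :: "'k mat \<Rightarrow> 'b \<Rightarrow> 'b" and n1 n2 :: nat
  assumes rep1: "representation (GL n1) V1 \<pi>1" and rep2: "representation (GL n2) V2 \<pi>2"
begin

lemma inflate_tensor_action:
  assumes "a \<in> carrier (GL n1)" "b \<in> carrier_mat n1 n2" "d \<in> carrier (GL n2)"
  shows "inflate n1 n2 (tensor_action V1 \<pi>1 V2 \<pi>2) (four_block_mat a b (0\<^sub>m n2 n1) d) =
    tensor_action V1 \<pi>1 V2 \<pi>2 (a, d)"
  using assms by (simp add: inflate_def split_block_four_block_mat[of _ n1 n1 _ n2 _ n2])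

lemma tensor_action_rep_hom:
  assumes "a \<in> carrier (GL n1)" "d \<in> carrier (GL n2)"
  shows "tensor_action V1 \<pi>1 V2 \<pi>2 (a, d)
    \<in> LinearCombinations.module_hom class_ring (tensor_module V1 V2) (tensor_module V1 V2)"
  by (rule tensor_action_hom[where \<rho> = \<pi>1 and g = a and \<sigma> = \<pi>2 and h = d,
        OF representationD(1)[OF rep1] representationD(1)[OF rep2]
          representationD(2)[OF rep1 assms(1)] representationD(2)[OF rep2 assms(2)]])

lemma tensor_action_rep_closed:
  assumes "a \<in> carrier (GL n1)" "d \<in> carrier (GL n2)" "t \<in> carrier (tensor_module V1 V2)"
  shows "tensor_action V1 \<pi>1 V2 \<pi>2 (a, d) t \<in> carrier (tensor_module V1 V2)"
  using LinearCombinations.module_hom_closed[OF tensor_action_rep_hom[OF assms(1,2)]] assms(3) by auto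

lemma tensor_action_rep_zero:
  assumes "a \<in> carrier (GL n1)" "d \<in> carrier (GL n2)"
  shows "tensor_action V1 \<pi>1 V2 \<pi>2 (a, d) \<zero>\<^bsub>tensor_module V1 V2\<^esub> = \<zero>\<^bsub>tensor_module V1 V2\<^esub>"
proof -
  note T = module_tensor[OF representationD(1)[OF rep1] representationD(1)[OF rep2]]
  show ?thesis by (rule module_hom_zero[OF T T tensor_action_rep_hom[OF assms]])
qed

text \<open>Shaped to rewrite the inductive step of \<open>tensor_induct\<close> under the
  action.\<close>

lemma tensor_action_rep_add_pure:
  assumes a: "a \<in> carrier (GL n1)" and d: "d \<in> carrier (GL n2)"
    and X: "X \<in> carrier (tensor_module V1 V2)" and v: "v \<in> carrier V1" and w: "w \<in> carrier V2"
  shows "tensor_action V1 \<pi>1 V2 \<pi>2 (a, d)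
      (X \<oplus>\<^bsub>tensor_module V1 V2\<^esub> r \<odot>\<^bsub>tensor_module V1 V2\<^esub> pure_tensor V1 V2 v w) =
    tensor_action V1 \<pi>1 V2 \<pi>2 (a, d) X
      \<oplus>\<^bsub>tensor_module V1 V2\<^esub> r \<odot>\<^bsub>tensor_module V1 V2\<^esub> pure_tensor V1 V2 (\<pi>1 a v) (\<pi>2 d w)"
proof -
  note V1 = representationD(1)[OF rep1] and V2 = representationD(1)[OF rep2]
  note hom = tensor_action_rep_hom[OF a d]
  interpret T: Module.module class_ring "tensor_module V1 V2" by (rule module_tensor[OF V1 V2])
  have pure: "pure_tensor V1 V2 v w \<in> carrier (tensor_module V1 V2)"
    by (rule pure_tensor_closed[OF V1 V2 v w])
  then have "r \<odot>\<^bsub>tensor_module V1 V2\<^esub> pure_tensor V1 V2 v w \<in> carrier (tensor_module V1 V2)"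
    by (intro T.smult_closed) simp_all
  moreover have "tensor_action V1 \<pi>1 V2 \<pi>2 (a, d) (pure_tensor V1 V2 v w) = pure_tensor V1 V2 (\<pi>1 a v) (\<pi>2 d w)"
    by (rule tensor_action_pure[where \<rho> = \<pi>1 and g = a and \<sigma> = \<pi>2 and h = d, OF V1 V2 representationD(2)[OF rep1 a] representationD(2)[OF rep2 d] v w])
  ultimately show ?thesis
    using LinearCombinations.module_hom_add[OF hom X] LinearCombinations.module_hom_smult[OF hom _ pure, of r]
    by simp
qed

text \<open>Diagonal blocks of block triangular matrices multiply separately, so inflation inherits
  multiplicativity from the tensor action.\<close>

lemma induction_datum_parabolic:
  "induction_datum (GL (n1 + n2)) (parabolic n1 n2) (tensor_module V1 V2)
     (inflate n1 n2 (tensor_action V1 \<pi>1 V2 \<pi>2))"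
proof (intro induction_datum.intro induction_datum_axioms.intro)
  note V1 = representationD(1)[OF rep1] and V2 = representationD(1)[OF rep2]
  let ?\<tau> = "tensor_action V1 \<pi>1 V2 \<pi>2"
  let ?T = "tensor_module V1 V2"
  show "Group.group (GL (n1 + n2) :: 'k mat monoid)" by (rule group_GL)
  show "subgroup (parabolic n1 n2 :: 'k mat set) (GL (n1 + n2))" by (rule subgroup_parabolic)
  show "Module.module class_ring ?T" by (rule module_tensor[OF V1 V2])
  show "inflate n1 n2 ?\<tau> p \<in> LinearCombinations.module_hom class_ring ?T ?T" if "p \<in> parabolic n1 n2" for p
    using that by (auto simp: parabolic_def inflate_tensor_action tensor_action_rep_hom)
  fix p p' :: "'k mat" and t assume "p \<in> parabolic n1 n2" "p' \<in> parabolic n1 n2" and t: "t \<in> carrier ?T"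
  then obtain a b d a' b' d' where p: "p = four_block_mat a b (0\<^sub>m n2 n1) d"
    "a \<in> carrier (GL n1)" "b \<in> carrier_mat n1 n2" "d \<in> carrier (GL n2)"
    and p': "p' = four_block_mat a' b' (0\<^sub>m n2 n1) d'"
    "a' \<in> carrier (GL n1)" "b' \<in> carrier_mat n1 n2" "d' \<in> carrier (GL n2)"
    unfolding parabolic_def by blast
  have c: "a * a' \<in> carrier (GL n1)" "d * d' \<in> carrier (GL n2)"
    using group.subgroup_self[OF group_GL, THEN subgroup.m_closed, OF p(2) p'(2)]
      group.subgroup_self[OF group_GL, THEN subgroup.m_closed, OF p(4) p'(4)] by simp_all
  \<comment> \<open>Both sides are linear in \<open>t\<close>, and on pure tensors the identity is
    the composition law of \<open>\<pi>1\<close> and \<open>\<pi>2\<close> in each factor.\<close>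
  have "?\<tau> (a * a', d * d') t = ?\<tau> (a, d) (?\<tau> (a', d') t)"
    using t
  proof (induction rule: tensor_induct[OF V1 V2, consumes 1, case_names zero add])
    case zero
    show ?case using c p(2,4) p'(2,4) by (simp add: tensor_action_rep_zero)
  next
    case (add X r v w)
    then show ?case
      using p(2,4) p'(2,4) c representationD(4)[OF rep1 p(2) p'(2), of v]
        representationD(4)[OF rep2 p(4) p'(4), of w]
      by (simp add: tensor_action_rep_add_pure tensor_action_rep_closed
          representationD(3)[OF rep1] representationD(3)[OF rep2])
  qed
  moreover have "p * p' = four_block_mat (a * a') (a * b' + b * d') (0\<^sub>m n2 n1) (d * d')"
    unfolding p(1) p'(1) using p(2-4) p'(2-4) by (intro block_triangular_mult) simp_all
  moreover have "a * b' + b * d' \<in> carrier_mat n1 n2"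
    using p(2-4) p'(2-4) by (metis GL_carrier_mat add_carrier_mat mult_carrier_mat)
  ultimately show "inflate n1 n2 ?\<tau> (p \<otimes>\<^bsub>GL (n1 + n2)\<^esub> p') t = inflate n1 n2 ?\<tau> p (inflate n1 n2 ?\<tau> p' t)"
    by (simp only: GL_simps inflate_tensor_action[OF c(1) _ c(2)] p(1) p'(1) inflate_tensor_action[OF p(2-4)]
        inflate_tensor_action[OF p'(2-4)])
qed

text \<open>\<open>Z m\<close> is the set where test functions must vanish, so both forms of the
  equation are proved together. The argument rests on two facts about \<open>Z\<close>: it is stable
  under translation by invertible matrices, and a block triangular matrix with a diagonal block in
  \<open>Z\<close> lies in \<open>Z\<close> itself.\<close>

lemma gamma_factor_parabolic_product:
  fixes \<psi> :: "'k \<Rightarrow> 'r"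
  assumes \<phi>: "\<phi> \<in> Ring.ring_hom (cyclotomic_ring CHAR('k)) class_ring"
    and \<psi>: "nontrivial_spectral_character \<phi> \<psi>"
    and s: "inv\<^bsub>class_ring\<^esub> s * of_nat (card (UNIV :: 'k set) ^ (n1 * n2)) =
      inv\<^bsub>class_ring\<^esub> s1 * inv\<^bsub>class_ring\<^esub> s2"
    and gamma1: "gamma_factor (vanishing (Z n1)) s1 \<psi> n1 V1 \<pi>1 \<gamma>1"
    and gamma2: "gamma_factor (vanishing (Z n2)) s2 \<psi> n2 V2 \<pi>2 \<gamma>2"
    and Z: "Z = (\<lambda>m. {}) \<or> Z = (\<lambda>m. carrier_mat m m - carrier (GL m))"
  shows "gamma_factor (vanishing (Z (n1 + n2))) s \<psi> (n1 + n2) (parabolic_product_module n1 n2 V1 \<pi>1 V2 \<pi>2)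
    (parabolic_product_action n1 n2 V1 \<pi>1 V2 \<pi>2) (\<gamma>1 * \<gamma>2)"
  unfolding parabolic_product_module_def parabolic_product_action_def
proof (rule gamma_factor_induced[OF induction_datum_parabolic])
  let ?n = "n1 + n2"
  let ?T = "tensor_module V1 V2" and ?\<tau> = "tensor_action V1 \<pi>1 V2 \<pi>2"
  let ?\<sigma> = "inflate n1 n2 ?\<tau>"
  let ?z = "0\<^sub>m n2 n1 :: 'k mat"
  note V1 = representationD(1)[OF rep1] and V2 = representationD(1)[OF rep2]
  interpret G: group "GL ?n :: 'k mat monoid" by (rule group_GL)
  fix \<Phi> :: "'k mat \<Rightarrow> 'r" assume \<Phi>: "\<Phi> \<in> vanishing (Z ?n)"
  {
    fix x k :: "'k mat" assume x: "x \<in> carrier (GL ?n)" and k: "k \<in> carrier (GL ?n)"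
    have "inv\<^bsub>GL ?n\<^esub> x * g * k \<in> Z ?n" if g: "g \<in> Z ?n" for g
    proof -
      let ?x = "inv\<^bsub>GL ?n\<^esub> x"
      \<comment> \<open>An element of \<open>Z ?n\<close> rules out the empty choice; what remains
        is that translation preserves singularity, by multiplicativity of the determinant.\<close>
      have Z': "Z ?n = carrier_mat ?n ?n - carrier (GL ?n)" using Z g by auto
      note c = g[unfolded Z'] GL_carrier_mat[OF x] GL_carrier_mat[OF k] GL_carrier_mat[OF GL_inv(1)[OF x]]
      have "det (?x * g * k) = det ?x * det g * det k"
        using c by (simp add: det_mult[of _ ?n])
      then show ?thesis
        using c unfolding Z' carrier_GL by auto
    qed
    then show "(\<lambda>g. \<Phi> (inv\<^bsub>GL ?n\<^esub> x * g * k)) \<in> vanishing (Z ?n)"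
      using \<Phi> by (simp add: vanishing_def)
  }
  fix l t assume l: "l \<in> dual ?T" and t: "t \<in> carrier ?T"
  \<comment> \<open>The default 0 matters for blocks of the wrong size: the vanishing of
    \<open>F\<close> is required for \<open>A\<close> in \<open>Z n1\<close> and arbitrary
    \<open>D\<close>, where nothing is known about \<open>\<Phi>\<close>.\<close>
  define F where "F A D = (if A \<in> carrier_mat n1 n1 \<and> D \<in> carrier_mat n2 n2
    then \<Sum>B\<in>carrier_mat n1 n2. \<Phi> (four_block_mat A B ?z D) else 0)" for A D
  have F1: "F A D = 0" if "A \<in> Z n1" for A D
    using that Z \<Phi> by (auto simp: F_def vanishing_def block_triangular_in_GL_iff intro!: sum.neutral)
  have F2: "F A D = 0" if "D \<in> Z n2" for A D
    using that Z \<Phi> by (auto simp: F_def vanishing_def block_triangular_in_GL_iff intro!: sum.neutral)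
  let ?P = "parabolic n1 n2 :: 'k mat set"
  let ?G1 = "carrier (GL n1) :: 'k mat set" and ?G2 = "carrier (GL n2) :: 'k mat set"
  let ?F = "\<lambda>a d. fourier s1 \<psi> n1 (\<lambda>A. fourier s2 \<psi> n2 (F A) d) a"
  \<comment> \<open>The transforms sum only over square blocks of the right sizes, where
    \<open>F\<close> agrees with the sum over the upper right block.\<close>
  have FF: "(\<Sum>b\<in>carrier_mat n1 n2. fourier s \<psi> ?n \<Phi> (four_block_mat a b ?z d)) = ?F a d"
    if "a \<in> ?G1" "d \<in> ?G2" for a d
    using that by (subst fourier_parabolic[OF \<phi> \<psi> s]) (simp_all add: fourier_def F_def)
  have inv_P: "inv\<^bsub>GL ?n\<^esub> p \<in> ?P" "inv\<^bsub>GL ?n\<^esub> (inv\<^bsub>GL ?n\<^esub> p) = p" if "p \<in> ?P" for p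
    using subgroup.m_inv_closed[OF subgroup_parabolic that]
      G.inv_inv[OF subgroup.mem_carrier[OF subgroup_parabolic that]] by simp_all
  \<comment> \<open>Inverting \<open>p\<close> moves the inverse from the transform to the action,
    so that \<open>fourier_parabolic\<close> can evaluate the sum over the unipotent block.\<close>
  have "(\<Sum>p\<in>?P. fourier s \<psi> ?n \<Phi> (inv\<^bsub>GL ?n\<^esub> p) * l (?\<sigma> p t)) =
      (\<Sum>p\<in>?P. fourier s \<psi> ?n \<Phi> p * l (?\<sigma> (inv\<^bsub>GL ?n\<^esub> p) t))"
    by (rule sum.reindex_bij_witness[where i = "m_inv (GL ?n)" and j = "m_inv (GL ?n)"])
      (simp_all add: inv_P)
  also have "\<dots> = (\<Sum>a\<in>?G1. \<Sum>d\<in>?G2. ?F a d * l (?\<tau> (inv\<^bsub>GL n1\<^esub> a, inv\<^bsub>GL n2\<^esub> d) t))"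
    unfolding sum_parabolic
  proof (intro sum.cong refl)
    fix a d :: "'k mat" assume a: "a \<in> ?G1" and d: "d \<in> ?G2"
    have inv: "?\<sigma> (inv\<^bsub>GL ?n\<^esub> four_block_mat a b ?z d) = ?\<tau> (inv\<^bsub>GL n1\<^esub> a, inv\<^bsub>GL n2\<^esub> d)"
      if b: "b \<in> carrier_mat n1 n2" for b
    proof -
      have "- (inv\<^bsub>GL n1\<^esub> a * b * inv\<^bsub>GL n2\<^esub> d) \<in> carrier_mat n1 n2"
        using b GL_inv(1)[OF a] GL_inv(1)[OF d]
        by (meson GL_carrier_mat mult_carrier_mat uminus_carrier_iff_mat)
      then show ?thesis
        unfolding block_triangular_inv[OF a b d] by (rule inflate_tensor_action[OF GL_inv(1)[OF a] _ GL_inv(1)[OF d]])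
    qed
    show "(\<Sum>b\<in>carrier_mat n1 n2. fourier s \<psi> ?n \<Phi> (four_block_mat a b ?z d) *
        l (?\<sigma> (inv\<^bsub>GL ?n\<^esub> four_block_mat a b ?z d) t)) =
      ?F a d * l (?\<tau> (inv\<^bsub>GL n1\<^esub> a, inv\<^bsub>GL n2\<^esub> d) t)"
      by (simp add: inv FF[OF a d, symmetric] sum_distrib_right)
  qed
  \<comment> \<open>Both sides are linear in \<open>t\<close>, which reduces the equation to pure
    tensors, where the two given gamma factors can act.\<close>
  also have "\<dots> = \<gamma>1 * \<gamma>2 * (\<Sum>a\<in>?G1. \<Sum>d\<in>?G2. F a d * l (?\<tau> (a, d) t))"
    using t
  proof (induction rule: tensor_induct[OF V1 V2, consumes 1, case_names zero add])
    case zero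
    show ?case
      by (simp add: GL_inv tensor_action_rep_zero dual_zero[OF module_tensor[OF V1 V2] l])
  next
    case (add X r v w)
    interpret T: Module.module class_ring ?T by (rule module_tensor[OF V1 V2])
    define \<beta> where "\<beta> v w = l (pure_tensor V1 V2 v w)" for v w
    have split: "l (?\<tau> (a, d) (X \<oplus>\<^bsub>?T\<^esub> r \<odot>\<^bsub>?T\<^esub> pure_tensor V1 V2 v w)) =
        l (?\<tau> (a, d) X) + r * \<beta> (\<pi>1 a v) (\<pi>2 d w)" if "a \<in> ?G1" "d \<in> ?G2" for a d
    proof -
      have pure: "pure_tensor V1 V2 (\<pi>1 a v) (\<pi>2 d w) \<in> carrier ?T"
        using that add.hyps by (intro pure_tensor_closed[OF V1 V2] representationD(3)[OF rep1] representationD(3)[OF rep2])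
      moreover have "r \<odot>\<^bsub>?T\<^esub> pure_tensor V1 V2 (\<pi>1 a v) (\<pi>2 d w) \<in> carrier ?T"
        by (rule T.smult_closed[OF _ pure]) simp
      ultimately show ?thesis
        using l tensor_action_rep_closed[OF that add.hyps(1)]
        by (simp add: tensor_action_rep_add_pure that add.hyps dual_iff \<beta>_def)
    qed
    have "(\<Sum>a\<in>?G1. \<Sum>d\<in>?G2. ?F a d * \<beta> (\<pi>1 (inv\<^bsub>GL n1\<^esub> a) v) (\<pi>2 (inv\<^bsub>GL n2\<^esub> d) w)) =
        \<gamma>1 * \<gamma>2 * (\<Sum>a\<in>?G1. \<Sum>d\<in>?G2. F a d * \<beta> (\<pi>1 a v) (\<pi>2 d w))"
      using dual_pure_tensor[OF V1 V2 l] add.hyps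
      by (intro gamma_factor_bilinear[OF rep1 rep2 gamma1 gamma2 _ _ F1 F2]) (auto simp: \<beta>_def)
    then show ?case
      using add.IH by (simp add: split GL_inv distrib_left sum.distrib sum_distrib_left mult.left_commute)
        (simp add: mult_ac flip: sum_distrib_left)
  qed
  also have "(\<Sum>a\<in>?G1. \<Sum>d\<in>?G2. F a d * l (?\<tau> (a, d) t)) = (\<Sum>p\<in>?P. \<Phi> p * l (?\<sigma> p t))"
    unfolding sum_parabolic
    by (intro sum.cong refl) (simp add: F_def inflate_tensor_action sum_distrib_right)
  finally show "(\<Sum>p\<in>?P. fourier s \<psi> ?n \<Phi> (inv\<^bsub>GL ?n\<^esub> p) * l (?\<sigma> p t)) =
    \<gamma>1 * \<gamma>2 * (\<Sum>p\<in>?P. \<Phi> p * l (?\<sigma> p t))" .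
qed

end

text \<open>Converts the compatibility of the square roots into the form in which it meets the order
  \<open>q\<close> of the unipotent radical produced by orthogonality.\<close>

lemma inverse_sqrt_card_mult:
  assumes "s \<in> Units (class_ring :: 'r::comm_ring_1 ring)" "s1 \<in> Units class_ring" "s2 \<in> Units class_ring"
    and "s = q * s1 * s2"
  shows "inv\<^bsub>class_ring\<^esub> s * q = inv\<^bsub>class_ring\<^esub> s1 * inv\<^bsub>class_ring\<^esub> s2"
proof -
  have inv: "inv\<^bsub>class_ring\<^esub> u * u = 1" if "u \<in> Units class_ring" for u :: 'r
    using class_semiring.Units_l_inv[OF that] .
  \<comment> \<open>Inserting the trivial factors for \<open>s1\<close> and \<open>s2\<close>
    completes \<open>q\<close> to \<open>s\<close>, which cancels.\<close>
  have "inv\<^bsub>class_ring\<^esub> s * q = inv\<^bsub>class_ring\<^esub> s * q * ((inv\<^bsub>class_ring\<^esub> s1 * s1) * (inv\<^bsub>class_ring\<^esub> s2 * s2))"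
    by (simp add: inv assms)
  also have "\<dots> = (inv\<^bsub>class_ring\<^esub> s * s) * (inv\<^bsub>class_ring\<^esub> s1 * inv\<^bsub>class_ring\<^esub> s2)"
    by (simp add: assms(4) mult_ac)
  finally show ?thesis by (simp add: inv assms(1))
qed

theorem theorem4p4:
  fixes \<phi> :: "complex \<Rightarrow> 'r::comm_ring_1"
    and \<psi> :: "'k::finite_field \<Rightarrow> 'r"
    and sqrt_card :: "nat \<Rightarrow> 'r"
    and n1 n2 n :: nat
    and V1 :: "('r, 'a) module" and \<pi>1 :: "'k mat \<Rightarrow> 'a \<Rightarrow> 'a"
    and V2 :: "('r, 'b) module" and \<pi>2 :: "'k mat \<Rightarrow> 'b \<Rightarrow> 'b"
    and V :: "('r, 'k mat \<Rightarrow> ('a \<times> 'b \<Rightarrow> 'r) set) module"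
    and \<rho> :: "'k mat \<Rightarrow> ('k mat \<Rightarrow> ('a \<times> 'b \<Rightarrow> 'r) set) \<Rightarrow> ('k mat \<Rightarrow> ('a \<times> 'b \<Rightarrow> 'r) set)"
    and W1 W2 :: "('k mat \<Rightarrow> ('a \<times> 'b \<Rightarrow> 'r) set) set"
    and U :: "('r, ('k mat \<Rightarrow> ('a \<times> 'b \<Rightarrow> 'r) set) set) module"
    and \<pi> :: "'k mat \<Rightarrow> ('k mat \<Rightarrow> ('a \<times> 'b \<Rightarrow> 'r) set) set \<Rightarrow> ('k mat \<Rightarrow> ('a \<times> 'b \<Rightarrow> 'r) set) set"
  assumes algebra: "\<phi> \<in> Ring.ring_hom (cyclotomic_ring CHAR('k)) class_ring"
    and mu_inj: "inj_on \<phi> (roots_of_unity CHAR('k))"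
    and n1: "n1 \<ge> 1" and n2: "n2 \<ge> 1" and n: "n = n1 + n2"
    and sqrt_card: "\<And>m. m \<in> {n1, n2, n} \<Longrightarrow> sqrt_card m \<in> Units class_ring \<and>
          (sqrt_card m)\<^sup>2 = of_nat (card (carrier_mat m m :: 'k mat set))"
    and sqrt_compat: "sqrt_card n = of_nat (card (UNIV :: 'k set) ^ (n1 * n2)) * sqrt_card n1 * sqrt_card n2"
    and \<psi>: "nontrivial_spectral_character \<phi> \<psi>"
    and rep1: "representation (GL n1) V1 \<pi>1"
    and rep2: "representation (GL n2) V2 \<pi>2"
    and V: "V = parabolic_product_module n1 n2 V1 \<pi>1 V2 \<pi>2"
    and \<rho>: "\<rho> = parabolic_product_action n1 n2 V1 \<pi>1 V2 \<pi>2"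
    and W1: "LinearCombinations.submodule class_ring W1 V" "stable (GL n) \<rho> W1"
    and W2: "LinearCombinations.submodule class_ring W2 V" "stable (GL n) \<rho> W2"
    and W2_W1: "W2 \<subseteq> W1"
    and U: "U = subquotient_module V W1 W2"
    and \<pi>: "\<pi> = subquotient_action V \<rho> W1 W2"
    and nonzero: "carrier U \<noteq> {\<zero>\<^bsub>U\<^esub>}"
    and restr_surj: "(\<lambda>l. restrict l W1) ` dual V = dual (V\<lparr>carrier := W1\<rparr>)"
  shows "(GJFE (sqrt_card n1) \<psi> n1 V1 \<pi>1 \<and> GJFE (sqrt_card n2) \<psi> n2 V2 \<pi>2 \<longrightarrow>
            GJFE (sqrt_card n) \<psi> n U \<pi> \<and>
            (\<forall>\<gamma>1 \<gamma>2. GJFE_gamma (sqrt_card n1) \<psi> n1 V1 \<pi>1 \<gamma>1 \<and>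
                      GJFE_gamma (sqrt_card n2) \<psi> n2 V2 \<pi>2 \<gamma>2 \<longrightarrow>
                      GJFE_gamma (sqrt_card n) \<psi> n U \<pi> (\<gamma>1 * \<gamma>2))) \<and>
         (WGJFE (sqrt_card n1) \<psi> n1 V1 \<pi>1 \<and> WGJFE (sqrt_card n2) \<psi> n2 V2 \<pi>2 \<longrightarrow>
            WGJFE (sqrt_card n) \<psi> n U \<pi> \<and>
            (\<forall>\<gamma>1 \<gamma>2. WGJFE_gamma (sqrt_card n1) \<psi> n1 V1 \<pi>1 \<gamma>1 \<and>
                      WGJFE_gamma (sqrt_card n2) \<psi> n2 V2 \<pi>2 \<gamma>2 \<longrightarrow>
                      WGJFE_gamma (sqrt_card n) \<psi> n U \<pi> (\<gamma>1 * \<gamma>2)))"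
proof -
  let ?Z = "\<lambda>m. carrier_mat m m - carrier (GL m) :: 'k mat set"
  have main: "gamma_factor (vanishing (Z n)) (sqrt_card n) \<psi> n U \<pi> (\<gamma>1 * \<gamma>2)"
    if Z: "Z = (\<lambda>m. {}) \<or> Z = ?Z"
      and gamma1: "gamma_factor (vanishing (Z n1)) (sqrt_card n1) \<psi> n1 V1 \<pi>1 \<gamma>1"
      and gamma2: "gamma_factor (vanishing (Z n2)) (sqrt_card n2) \<psi> n2 V2 \<pi>2 \<gamma>2"
    for Z :: "nat \<Rightarrow> 'k mat set" and \<gamma>1 \<gamma>2
  proof -
    have s: "inv\<^bsub>class_ring\<^esub> sqrt_card n * of_nat (card (UNIV :: 'k set) ^ (n1 * n2)) =
        inv\<^bsub>class_ring\<^esub> sqrt_card n1 * inv\<^bsub>class_ring\<^esub> sqrt_card n2"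
      using sqrt_card by (intro inverse_sqrt_card_mult sqrt_compat) simp_all
    have "gamma_factor (vanishing (Z n)) (sqrt_card n) \<psi> n V \<rho> (\<gamma>1 * \<gamma>2)"
      unfolding V \<rho> n
      by (rule gamma_factor_parabolic_product[OF rep1 rep2 algebra \<psi> s[unfolded n] gamma1 gamma2 Z])
    moreover have "\<rho> g (v \<oplus>\<^bsub>V\<^esub> w) = \<rho> g v \<oplus>\<^bsub>V\<^esub> \<rho> g w"
      if "g \<in> carrier (GL n)" "v \<in> carrier V" "w \<in> carrier V" for g v w
      using that induction_datum.induced_action_add[OF induction_datum_parabolic[OF rep1 rep2]]
      unfolding V \<rho> n parabolic_product_module_def parabolic_product_action_def by blast
    ultimately show ?thesis
      unfolding U \<pi> using restr_surj by (intro gamma_factor_subquotient[OF W1 W2 W2_W1]) auto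
  qed
  have all: "(UNIV :: ('k mat \<Rightarrow> 'r) set) = vanishing ((\<lambda>m. {}) m)" for m :: nat
    by (simp add: vanishing_def)
  have supp: "(GL_supported m :: ('k mat \<Rightarrow> 'r) set) = vanishing (?Z m)" for m
    by (simp add: vanishing_def GL_supported_def)
  have "GJFE_gamma (sqrt_card n) \<psi> n U \<pi> (\<gamma>1 * \<gamma>2)"
    if "GJFE_gamma (sqrt_card n1) \<psi> n1 V1 \<pi>1 \<gamma>1" "GJFE_gamma (sqrt_card n2) \<psi> n2 V2 \<pi>2 \<gamma>2" for \<gamma>1 \<gamma>2
    using main[of "\<lambda>m. {}"] that unfolding all by blast
  moreover have "WGJFE_gamma (sqrt_card n) \<psi> n U \<pi> (\<gamma>1 * \<gamma>2)"
    if "WGJFE_gamma (sqrt_card n1) \<psi> n1 V1 \<pi>1 \<gamma>1" "WGJFE_gamma (sqrt_card n2) \<psi> n2 V2 \<pi>2 \<gamma>2" for \<gamma>1 \<gamma>2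
    using main[of ?Z] that unfolding supp by blast
  \<comment> \<open>The product of any two witnesses for \<open>\<pi>1\<close> and
    \<open>\<pi>2\<close> also proves the existence of a gamma factor for
    \<open>\<pi>\<close>.\<close>
  ultimately show ?thesis
    unfolding GJFE_def WGJFE_def by blast
qed

end
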